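(* Let $\Sigma_A^\ell$, $\mu$, $J$, $\Pi_\lambda$, $\nu_\lambda$ and $\phi_{\omega,\tau}$ be as described in the context. Suppose that there exist constants $C_1,C_2,C_3,C_4,\alpha,\beta,\gamma>0$ and $k_0\in\mathbb{Z}_+$ such that $$\max_{\lambda\in J}|\phi_{\omega,\tau}(\lambda)|\le C_1\ell^{-\alpha|\omega\wedge\tau|}\quad\text{for all }\omega,\tau\in\Sigma_A^\ell,\ \omega\ne\tau;$$ $$\sup_{v\in\mathbb{R}}\mathcal{L}^1\big(\{\lambda\in J:\ |v+\phi_{\omega,\tau}(\lambda)|\le r\}\big)\le C_2\,\ell^{|\omega\wedge\tau|\beta}\,r\quad\text{for all } r>0 \text{ and all }\omega,\tau\in\Sigma_A^\ell,\ \omega\neq\tau, \text{ with } |\omega\wedge\tau|\ge k_0;$$ and $$\max_{u\in\mathcal{A}^n}\mu([u])\le C_3\ell^{-\gamma n}\quad\text{for all }n\ge1.$$ Further, let $\eta$ be a compactly supported Borel probability measure on $\mathbb{R}$ and $d_\eta\ge 0$ a number satisfying $$\eta([x-r,x+r])\le C_4r^{d_\eta}\quad\text{for all }x\in\mathbb{R},\ r>0.$$ If $$d_\eta+\frac{\gamma}{\beta}>1\quad\text{and}\quad d_\eta>\frac{\beta-\gamma}{\alpha},$$ then for Lebesgue-a.e. $\lambda\in J$ the convolution $\eta*\nu_\lambda$ is absolutely continuous with respect to $\mathcal{L}^1$ with density in $L^2$.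
   Context: $\mathcal{L}^1$ is one-dimensional Lebesgue measure and $\mathbb{Z}_+=\{0,1,2,\ldots\}$. $\mathcal{A}$ is a finite alphabet with $|\mathcal{A}|=\ell\ge2$; $\mathcal{A}^{\mathbb{Z}_+}$ carries the product topology. $A$ is a primitive $0$--$1$ matrix of size $\ell\times\ell$ and $\Sigma_A^\ell\subset\mathcal{A}^{\mathbb{Z}_+}$ is the one-sided topological Markov chain: $\omega=\omega_0\omega_1\ldots\in\Sigma_A^\ell$ iff $A_{\omega_m\omega_{m+1}}=1$ for all $m\ge0$. $\mu$ is a Borel probability measure on $\Sigma_A^\ell$. $J=[\lambda_0,\lambda_1]\subset\mathbb{R}$ is a parameter interval, and $\Pi_\lambda:\Sigma_A^\ell\to\mathbb{R}$, $\lambda\in J$, is a family of continuous maps whose images $\Pi_\lambda(\Sigma_A^\ell)$ are Cantor sets; $\nu_\lambda=\mu\circ\Pi_\lambda^{-1}$. For a word $u\in\mathcal{A}^n$, $[u]=\{\omega\in\Sigma_A^\ell:\omega_0\ldots\omega_{n-1}=u\}$. For $\omega,\tau\in\Sigma_A^\ell$, $\omega\wedge\tau$ is their maximal common prefix, of length $|\omega\wedge\tau|$ (equal to $0$ if $\omega_0\ne\tau_0$), and $\phi_{\omega,\tau}(\lambda)=\Pi_\lambda(\omega)-\Pi_\lambda(\tau)$. *)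

theory Defs
  imports "HOL-Probability.Probability"
begin

definition zero_one_matrix :: "real^'n^'n \<Rightarrow> bool" where
  "zero_one_matrix A \<longleftrightarrow> (\<forall>i j. A $ i $ j \<in> {0, 1})"

primrec matrix_power :: "real^'n^'n \<Rightarrow> nat \<Rightarrow> real^'n^'n" where
  "matrix_power A 0 = mat 1"
| "matrix_power A (Suc k) = A ** matrix_power A k"

definition primitive_matrix :: "real^'n^'n \<Rightarrow> bool" where
  "primitive_matrix A \<longleftrightarrow>
     (\<forall>i j. 0 \<le> A $ i $ j) \<and> (\<exists>k\<ge>1. \<forall>i j. 0 < matrix_power A k $ i $ j)"

text \<open>
  The alphabet is the index type of the transition matrix. When that type carries the discrete
  topology, the library's topology on \<^typ>\<open>nat \<Rightarrow> 'a\<close> is the product topology on one-sided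
  sequences.
\<close>

definition markov_chain :: "real^'a^'a \<Rightarrow> (nat \<Rightarrow> 'a) set" where
  "markov_chain A = {\<omega>. \<forall>m. A $ \<omega> m $ \<omega> (Suc m) = 1}"

definition cylinder :: "real^'a^'a \<Rightarrow> 'a list \<Rightarrow> (nat \<Rightarrow> 'a) set" where
  "cylinder A u = {\<omega> \<in> markov_chain A. map \<omega> [0..<length u] = u}"

text \<open>
  The first index at which two sequences differ equals the length of their maximal common prefix;
  the value is meaningful only for distinct sequences.
\<close>

definition common_prefix_length :: "(nat \<Rightarrow> 'a) \<Rightarrow> (nat \<Rightarrow> 'a) \<Rightarrow> nat" where
  "common_prefix_length \<omega> \<tau> = (LEAST n. \<omega> n \<noteq> \<tau> n)"

definition phi :: "(real \<Rightarrow> (nat \<Rightarrow> 'a) \<Rightarrow> real) \<Rightarrow> (nat \<Rightarrow> 'a) \<Rightarrow> (nat \<Rightarrow> 'a) \<Rightarrow> real \<Rightarrow> real" where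
  "phi P \<omega> \<tau> t = P t \<omega> - P t \<tau>"

text \<open>Nonempty, compact, perfect and totally disconnected.\<close>

definition cantor_set :: "real set \<Rightarrow> bool" where
  "cantor_set K \<longleftrightarrow> K \<noteq> {} \<and> compact K \<and> (\<forall>x\<in>K. x islimpt K) \<and>
     (\<forall>C. C \<subseteq> K \<and> connected C \<longrightarrow> (\<forall>x\<in>C. \<forall>y\<in>C. x = y))"

definition measure_support :: "real measure \<Rightarrow> real set" where
  "measure_support M = {x. \<forall>U. open U \<and> x \<in> U \<longrightarrow> 0 < emeasure M U}"

end

theory Submission
  imports Defs
begin

text \<open>
  Write \<open>closeness M v r\<close> for the mass that \<open>M \<Otimes> M\<close> gives to the pairs with \<open>\<bar>x - y + v\<bar> \<le> r\<close>.
  If a finite measure \<open>\<theta>\<close> on the line satisfies \<open>closeness \<theta> 0 r \<le> K r\<close> along a sequence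
  \<open>r \<rightarrow> 0\<close>, then the averages \<open>\<theta> [y - r, y + r] / (2 r)\<close> stay bounded in \<open>L\<^sup>2\<close>, and Cauchy--Schwarz
  gives \<open>(\<integral>g \<partial>\<theta>)\<^sup>2 \<le> K \<integral>g\<^sup>2\<close> for all Borel \<open>g \<ge> 0\<close> (\<open>L2_bound_of_energy\<close>). Such a bound forces an
  \<open>L\<^sup>2\<close> density (\<open>L2_density_of_bound\<close>). By Fatou's lemma in the parameter, it therefore suffices that
  the closeness of the convolution at scale \<open>\<rho>\<close>, integrated over the parameter interval, is \<open>O(\<rho>)\<close>
  (\<open>piece_energy\<close>).

  At a fixed scale \<open>\<rho>\<close>, the image of \<open>\<mu>\<close> may be replaced by finitely many atoms, one for each
  cylinder of a large length \<open>n\<close>; the energy of the convolution is then at most a weighted sum of terms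
  \<open>closeness \<eta> (\<phi> t) \<rho>\<close>, one for each pair of cylinders (\<open>closeness_convolution_le_sum\<close>). Consider
  a pair whose common prefix has length \<open>k\<close>, and let \<open>b\<close> be the size of the alphabet. The Frostman bound
  on \<open>\<eta>\<close> alone bounds the integrated term by \<open>O(\<rho>\<^sup>d)\<close>. Transversality bounds it by
  \<open>O(b powr (k \<beta>) \<rho> (\<rho> + b powr (- \<alpha> k)) powr d)\<close>, because the two images are at distance
  \<open>O(b powr (- \<alpha> k))\<close> and so only pairs \<open>(x, y)\<close> with \<open>\<bar>x - y\<bar> \<le> \<rho> + O(b powr (- \<alpha> k))\<close> contribute.
  Interpolating between the two with exponent \<open>s = max 0 (1 - d)\<close> gives
  \<open>O(\<rho>) (b powr (k (\<beta> - \<alpha> d)) + b powr (k \<beta> s))\<close> (\<open>pair_energy\<close>). Pairs with common prefix of length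
  \<open>k\<close> have total mass \<open>O(b powr (- \<gamma> k))\<close>, and the two dimension conditions make the resulting
  geometric series, with ratios \<open>b powr (\<beta> - \<alpha> d - \<gamma>)\<close> and \<open>b powr (\<beta> s - \<gamma>)\<close>, converge. The pairs of
  equal cylinders are negligible once \<open>n\<close> is large.

  Transversality concerns only pairs that share their first \<open>k0\<close> symbols. The convolution is
  therefore cut into finitely many pieces, one for each word of length \<open>k0\<close>. The argument
  applies to each piece, and \<open>L\<^sup>2\<close> bounds of the above form survive finite sums.
\<close>

section \<open>Energy and square-integrable densities\<close>

text \<open>
  A quadratic bound \<open>x\<^sup>2 \<le> C\<close> on extended nonnegative reals is linearised to \<open>x \<le> B\<close>, including
  \<open>C = \<infinity>\<close>, so that it passes through limits, suprema and sums.
\<close>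

lemma ennreal_ex_sqrt: "\<exists>B::ennreal. B\<^sup>2 = C \<and> (\<forall>x. x\<^sup>2 \<le> C \<longleftrightarrow> x \<le> B)"
proof (cases C)
  case (real c)
  have "(ennreal (sqrt c))\<^sup>2 = C" using real by (simp add: ennreal_power)
  moreover have "x\<^sup>2 \<le> C \<longleftrightarrow> x \<le> ennreal (sqrt c)" for x
  proof (cases x)
    case (real y)
    then show ?thesis
      using \<open>C = _\<close> \<open>0 \<le> c\<close>
      by (auto simp: ennreal_power real_le_rsqrt sqrt_ge_absD dest: real_sqrt_le_mono)
  next
    case top
    then show ?thesis using real by (simp add: power2_eq_square ennreal_mult_top top_unique)
  qed
  ultimately show ?thesis by blast
next
  case top
  then show ?thesis by (intro exI[of _ \<top>]) (simp add: power2_eq_square ennreal_mult_top)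
qed

text \<open>
  The double integral is \<open>(M \<Otimes> M) {(x, y). \<bar>x - y + v\<bar> \<le> r}\<close>; the shift \<open>v\<close> makes room for the
  difference of two translates of \<open>M\<close>.
\<close>

definition closeness :: "real measure \<Rightarrow> real \<Rightarrow> real \<Rightarrow> ennreal" where
  "closeness M v r = (\<integral>\<^sup>+x. \<integral>\<^sup>+y. indicator {-r..r} (x - y + v) \<partial>M \<partial>M)"

lemma nn_integral_indicator_interval:
  fixes M :: "real measure"
  assumes "sets M = sets borel"
  shows "(\<integral>\<^sup>+y. indicator {-r..r} (x - y + v) \<partial>M) = emeasure M {x + v - r..x + v + r}"
proof -
  have "(\<integral>\<^sup>+y. indicator {-r..r} (x - y + v) \<partial>M) = (\<integral>\<^sup>+y. indicator {x + v - r..x + v + r} y \<partial>M)"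
    by (intro nn_integral_cong) (auto split: split_indicator)
  then show ?thesis using assms by simp
qed

text \<open>
  The core of the density criterion. The function \<open>g\<close> is a supremum of multiples of indicators of
  open sets, hence lower semicontinuous: at every point it is at most the lower limit of its averages
  over shrinking intervals. Fatou's lemma bounds \<open>\<integral>g \<partial>\<theta>\<close> by the integrals of these averages.
  By duality, averaging \<open>g\<close> against \<open>\<theta>\<close> is the same as integrating \<open>g\<close> against the averages \<open>h\<close> of
  \<open>\<theta>\<close>, and the energy controls \<open>\<integral>h\<^sup>2\<close>, because two intervals of radius \<open>r\<close> meet only if their centres
  are within \<open>2 r\<close>.
\<close>

lemma L2_bound_open_levels:
  fixes \<theta> :: "real measure" and U :: "nat \<Rightarrow> real set" and a :: "nat \<Rightarrow> ennreal"
  assumes fin: "finite_measure \<theta>" and sets[measurable_cong]: "sets \<theta> = sets borel"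
    and r0: "\<And>m::nat. 0 < r m" and r: "r \<longlonglongrightarrow> 0"
    and energy: "\<And>m. closeness \<theta> 0 (2 * r m) \<le> ennreal (K * (2 * r m))" and "0 \<le> K"
    and U: "\<And>i. open (U i)"
  defines "g \<equiv> \<lambda>x. SUP i. a i * indicator (U i) x"
  shows "(\<integral>\<^sup>+x. g x \<partial>\<theta>)\<^sup>2 \<le> ennreal K * (\<integral>\<^sup>+x. (g x)\<^sup>2 \<partial>lborel)"
proof -
  interpret T: finite_measure \<theta> by fact
  interpret pair_sigma_finite \<theta> lborel ..
  interpret TT: pair_sigma_finite \<theta> \<theta> ..
  have [measurable]: "U i \<in> sets borel" for i using U by simp
  have [measurable]: "g \<in> borel_measurable borel" unfolding g_def by measurable
  define I where "I = (\<lambda>m x y. indicator {- r m..r m} (x - y) :: ennreal)"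
  define avg where "avg = (\<lambda>m x. ennreal (1 / (2 * r m)) * (\<integral>\<^sup>+y. g y * I m x y \<partial>lborel))"
  define h where "h = (\<lambda>m y. ennreal (1 / (2 * r m)) * (\<integral>\<^sup>+x. I m x y \<partial>\<theta>))"
  have I_m[measurable]: "(\<lambda>(x, y). I m x y) \<in> borel_measurable (borel \<Otimes>\<^sub>M borel)" for m
    unfolding I_def by measurable
  have avg_m[measurable]: "avg m \<in> borel_measurable borel" for m unfolding avg_def by measurable
  have h_m[measurable]: "h m \<in> borel_measurable borel" for m unfolding h_def by measurable
  have mass: "(\<integral>\<^sup>+y. I m x y \<partial>lborel) = ennreal (2 * r m)" for m x
    using nn_integral_indicator_interval[of lborel "r m" x 0] r0[of m] by (simp add: I_def)
  have norm: "ennreal (1 / (2 * r m)) * ennreal (2 * r m) = 1" for m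
    using r0[of m] by (subst ennreal_mult[symmetric]) auto
  have lower: "g x \<le> liminf (\<lambda>m. avg m x)" for x
    unfolding g_def
  proof (rule SUP_least)
    fix i
    show "a i * indicator (U i) x \<le> liminf (\<lambda>m. avg m x)"
    proof (cases "x \<in> U i")
      case True
      then obtain e where e: "e > 0" "ball x e \<subseteq> U i" using U[of i] open_contains_ball by blast
      have "\<forall>\<^sub>F m in sequentially. r m < e" using r e(1) by (rule order_tendstoD)
      then have "\<forall>\<^sub>F m in sequentially. a i \<le> avg m x"
      proof eventually_elim
        case (elim m)
        have "a i * I m x y \<le> g y * I m x y" for y
        proof (cases "I m x y = 0")
          case False
          then have "\<bar>x - y\<bar> \<le> r m" by (auto simp: I_def split: split_indicator_asm)
          then have "y \<in> U i" using e(2) elim by (auto simp: dist_real_def subset_eq)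
          then have "a i \<le> g y" unfolding g_def by (intro SUP_upper2[of i]) auto
          then show ?thesis by (intro mult_right_mono) auto
        qed auto
        then have "(\<integral>\<^sup>+y. a i * I m x y \<partial>lborel) \<le> (\<integral>\<^sup>+y. g y * I m x y \<partial>lborel)"
          by (intro nn_integral_mono)
        then have "ennreal (1 / (2 * r m)) * (a i * ennreal (2 * r m)) \<le> avg m x"
          unfolding avg_def by (intro mult_left_mono) (auto simp: nn_integral_cmult mass)
        also have "ennreal (1 / (2 * r m)) * (a i * ennreal (2 * r m)) = a i"
          using norm[of m] by (metis mult.left_commute mult.right_neutral)
        finally show ?case .
      qed
      then show ?thesis using True by (auto intro: Liminf_bounded)
    qed auto
  qed
  have dual: "(\<integral>\<^sup>+x. avg m x \<partial>\<theta>) = (\<integral>\<^sup>+y. g y * h m y \<partial>lborel)" for m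
  proof -
    have "(\<integral>\<^sup>+x. avg m x \<partial>\<theta>) = ennreal (1 / (2 * r m)) * (\<integral>\<^sup>+x. \<integral>\<^sup>+y. g y * I m x y \<partial>lborel \<partial>\<theta>)"
      unfolding avg_def by (subst nn_integral_cmult) auto
    also have "(\<integral>\<^sup>+x. \<integral>\<^sup>+y. g y * I m x y \<partial>lborel \<partial>\<theta>) = (\<integral>\<^sup>+y. \<integral>\<^sup>+x. g y * I m x y \<partial>\<theta> \<partial>lborel)"
      by (rule Fubini'[symmetric]) measurable
    also have "\<dots> = (\<integral>\<^sup>+y. g y * (\<integral>\<^sup>+x. I m x y \<partial>\<theta>) \<partial>lborel)"
      by (intro nn_integral_cong nn_integral_cmult) measurable
    also have "ennreal (1 / (2 * r m)) * \<dots> = (\<integral>\<^sup>+y. g y * h m y \<partial>lborel)"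
      unfolding h_def by (subst nn_integral_cmult[symmetric]) (auto simp: mult_ac)
    finally show ?thesis .
  qed
  have h2: "(\<integral>\<^sup>+y. (h m y)\<^sup>2 \<partial>lborel) \<le> ennreal K" for m
  proof -
    have sq: "(\<integral>\<^sup>+x. I m x y \<partial>\<theta>)\<^sup>2 = (\<integral>\<^sup>+x. \<integral>\<^sup>+x'. I m x y * I m x' y \<partial>\<theta> \<partial>\<theta>)" for y
      unfolding power2_eq_square by (simp add: nn_integral_cmult nn_integral_multc)
    have "(\<integral>\<^sup>+y. (\<integral>\<^sup>+x. I m x y \<partial>\<theta>)\<^sup>2 \<partial>lborel)
        = (\<integral>\<^sup>+x. \<integral>\<^sup>+y. \<integral>\<^sup>+x'. I m x y * I m x' y \<partial>\<theta> \<partial>lborel \<partial>\<theta>)"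
      unfolding sq by (rule Fubini') measurable
    also have "\<dots> = (\<integral>\<^sup>+x. \<integral>\<^sup>+x'. \<integral>\<^sup>+y. I m x y * I m x' y \<partial>lborel \<partial>\<theta> \<partial>\<theta>)"
      by (intro nn_integral_cong Fubini') measurable
    also have "\<dots> \<le> (\<integral>\<^sup>+x. \<integral>\<^sup>+x'. ennreal (2 * r m) * indicator {- (2 * r m)..2 * r m} (x - x' + 0) \<partial>\<theta> \<partial>\<theta>)"
    proof (intro nn_integral_mono)
      fix x x'
      have "(\<integral>\<^sup>+y. I m x y * I m x' y \<partial>lborel)
          \<le> (\<integral>\<^sup>+y. indicator {- (2 * r m)..2 * r m} (x - x' + 0) * I m x y \<partial>lborel)"
        by (intro nn_integral_mono) (auto simp: I_def split: split_indicator)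
      also have "\<dots> = indicator {- (2 * r m)..2 * r m} (x - x' + 0) * ennreal (2 * r m)"
        by (subst nn_integral_cmult) (auto simp: mass)
      finally show "(\<integral>\<^sup>+y. I m x y * I m x' y \<partial>lborel)
          \<le> ennreal (2 * r m) * indicator {- (2 * r m)..2 * r m} (x - x' + 0)"
        by (simp add: mult.commute)
    qed
    also have "\<dots> = ennreal (2 * r m) * closeness \<theta> 0 (2 * r m)"
      unfolding closeness_def by (simp add: nn_integral_cmult)
    also have "\<dots> \<le> ennreal (2 * r m) * ennreal (K * (2 * r m))"
      by (intro mult_left_mono energy) auto
    finally have *: "(\<integral>\<^sup>+y. (\<integral>\<^sup>+x. I m x y \<partial>\<theta>)\<^sup>2 \<partial>lborel) \<le> ennreal (2 * r m) * ennreal (K * (2 * r m))" .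
    have "(\<integral>\<^sup>+y. (h m y)\<^sup>2 \<partial>lborel)
        = ennreal (1 / (2 * r m)) ^ 2 * (\<integral>\<^sup>+y. (\<integral>\<^sup>+x. I m x y \<partial>\<theta>)\<^sup>2 \<partial>lborel)"
      unfolding h_def power_mult_distrib by (subst nn_integral_cmult) auto
    also have "\<dots> \<le> ennreal (1 / (2 * r m)) ^ 2 * (ennreal (2 * r m) * ennreal (K * (2 * r m)))"
      using * by (intro mult_left_mono) auto
    also have "\<dots> = ennreal K"
      using r0[of m] \<open>0 \<le> K\<close>
      by (simp add: ennreal_power flip: ennreal_mult) (simp add: power2_eq_square)
    finally show ?thesis .
  qed
  define C where "C = ennreal K * (\<integral>\<^sup>+x. (g x)\<^sup>2 \<partial>lborel)"
  obtain B where B: "\<And>x::ennreal. x\<^sup>2 \<le> C \<longleftrightarrow> x \<le> B" using ennreal_ex_sqrt by metis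
  have "(\<integral>\<^sup>+x. g x \<partial>\<theta>) \<le> (\<integral>\<^sup>+x. liminf (\<lambda>m. avg m x) \<partial>\<theta>)"
    by (intro nn_integral_mono lower)
  also have "\<dots> \<le> liminf (\<lambda>m. \<integral>\<^sup>+x. avg m x \<partial>\<theta>)"
    by (rule nn_integral_liminf) measurable
  also have "\<dots> \<le> B"
  proof -
    have "(\<integral>\<^sup>+x. avg m x \<partial>\<theta>) \<le> B" for m
    proof -
      have "(\<integral>\<^sup>+y. g y * h m y \<partial>lborel)\<^sup>2 \<le> (\<integral>\<^sup>+x. (g x)\<^sup>2 \<partial>lborel) * (\<integral>\<^sup>+y. (h m y)\<^sup>2 \<partial>lborel)"
        by (rule Cauchy_Schwarz_nn_integral) auto
      also have "\<dots> \<le> (\<integral>\<^sup>+x. (g x)\<^sup>2 \<partial>lborel) * ennreal K"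
        by (intro mult_left_mono h2) auto
      finally show ?thesis by (simp add: dual C_def mult.commute flip: B)
    qed
    then have "liminf (\<lambda>m. \<integral>\<^sup>+x. avg m x \<partial>\<theta>) \<le> liminf (\<lambda>m::nat. B)"
      by (intro Liminf_mono always_eventually) auto
    then show ?thesis by (simp add: Liminf_const)
  qed
  finally show ?thesis by (simp flip: B add: C_def)
qed

text \<open>
  Outer regularity of Lebesgue measure reduces a simple function to the previous case: each level set
  is enlarged to an open set of almost the same measure. Taking the supremum over the levels, rather
  than the sum, keeps the square of the enlarged function below the sum of the squared levels.
\<close>

lemma L2_bound_simple_function:
  fixes \<theta> :: "real measure" and s :: "real \<Rightarrow> ennreal"
  assumes sets[measurable_cong]: "sets \<theta> = sets borel" and "0 \<le> K"
    and lsc: "\<And>(U :: nat \<Rightarrow> real set) a. (\<And>i. open (U i)) \<Longrightarrow>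
       (\<integral>\<^sup>+x. (SUP i. a i * indicator (U i) x) \<partial>\<theta>)\<^sup>2
         \<le> ennreal K * (\<integral>\<^sup>+x. (SUP i. a i * indicator (U i) x)\<^sup>2 \<partial>lborel)"
    and s: "simple_function lborel s" "\<And>x. s x < \<top>"
  shows "(\<integral>\<^sup>+x. s x \<partial>\<theta>)\<^sup>2 \<le> ennreal K * (\<integral>\<^sup>+x. (s x)\<^sup>2 \<partial>lborel)"
proof -
  define E where "E y = s -` {y}" for y
  define Y where "Y = range s"
  have finY: "finite Y" using s(1) by (auto simp: Y_def simple_function_def)
  have [measurable]: "E y \<in> sets borel" for y
    using simple_functionD(2)[OF s(1), of "{y}"] by (simp add: E_def)
  have [measurable]: "s \<in> borel_measurable borel"
    using borel_measurable_simple_function[OF s(1)] by simp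
  define c where "c = (\<Sum>y\<in>Y. y\<^sup>2)"
  have "y\<^sup>2 < \<top>" if "y \<in> Y" for y
    using that s(2) unfolding Y_def by (auto simp: power2_eq_square ennreal_mult_less_top)
  then have "c < \<top>" unfolding c_def using finY by (subst ennreal_sum_less_top) auto
  define T where "T = (\<integral>\<^sup>+x. (s x)\<^sup>2 \<partial>lborel)"
  have s2: "(s x)\<^sup>2 = (\<Sum>y\<in>Y. y\<^sup>2 * indicator (E y) x)" for x
  proof -
    have "(\<Sum>y\<in>Y. y\<^sup>2 * indicator (E y) x) = (\<Sum>y\<in>Y. if y = s x then y\<^sup>2 else 0)"
      by (intro sum.cong) (auto simp: E_def)
    also have "\<dots> = (s x)\<^sup>2" using finY by (auto simp: Y_def)
    finally show ?thesis by simp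
  qed
  have bound: "(\<integral>\<^sup>+x. s x \<partial>\<theta>)\<^sup>2 \<le> ennreal K * (T + c * ennreal e)" if "0 < e" for e :: real
  proof -
    have "\<exists>V. open V \<and> E y \<subseteq> V \<and> emeasure lborel (V - E y) < ennreal e" for y
      by (rule outer_regular_lborel[of "E y" e]) (use that in auto)
    then obtain V where V: "\<And>y. open (V y)" "\<And>y. E y \<subseteq> V y"
      "\<And>y. emeasure lborel (V y - E y) < ennreal e" by metis
    have [measurable]: "V y \<in> sets borel" for y using V(1) by simp
    \<comment> \<open>The finite set of values is listed as a sequence, with repetitions, which leaves the supremum unchanged.\<close>
    define b where "b = from_nat_into Y"
    have b: "range b = Y"
      unfolding b_def by (rule range_from_nat_into) (auto simp: Y_def finY[unfolded Y_def] intro: countable_finite)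
    define g where "g x = (SUP i. b i * indicator (V (b i)) x)" for x
    have gY: "g x = (SUP y\<in>Y. y * indicator (V y) x)" for x
      unfolding g_def b[symmetric] by (simp add: image_image)
    have [measurable]: "g \<in> borel_measurable borel" unfolding g_def by measurable
    have "s x \<le> g x" for x
      unfolding gY using V(2)[of "s x"]
      by (intro SUP_upper2[of "s x"]) (auto simp: Y_def E_def split: split_indicator)
    then have "(\<integral>\<^sup>+x. s x \<partial>\<theta>)\<^sup>2 \<le> (\<integral>\<^sup>+x. g x \<partial>\<theta>)\<^sup>2"
      by (intro power_mono nn_integral_mono) auto
    also have "\<dots> \<le> ennreal K * (\<integral>\<^sup>+x. (g x)\<^sup>2 \<partial>lborel)"
      unfolding g_def by (rule lsc[where a=b and U="\<lambda>i. V (b i)"]) (rule V(1))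
    also have "(\<integral>\<^sup>+x. (g x)\<^sup>2 \<partial>lborel) \<le> (\<integral>\<^sup>+x. (\<Sum>y\<in>Y. y\<^sup>2 * indicator (V y) x) \<partial>lborel)"
    proof (intro nn_integral_mono)
      fix x
      have "g x \<in> (\<lambda>y. y * indicator (V y) x) ` Y"
        unfolding gY using finY by (subst Max_Sup[symmetric]) (auto simp: Y_def)
      then obtain y where y: "y \<in> Y" "g x = y * indicator (V y) x" by auto
      then have "(g x)\<^sup>2 = y\<^sup>2 * indicator (V y) x"
        by (auto split: split_indicator)
      also have "\<dots> \<le> (\<Sum>y\<in>Y. y\<^sup>2 * indicator (V y) x)"
        using finY y(1) by (intro member_le_sum) auto
      finally show "(g x)\<^sup>2 \<le> (\<Sum>y\<in>Y. y\<^sup>2 * indicator (V y) x)" .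
    qed
    also have "\<dots> = (\<Sum>y\<in>Y. y\<^sup>2 * emeasure lborel (V y))"
      by (subst nn_integral_sum) (auto simp: nn_integral_cmult_indicator)
    also have "\<dots> \<le> (\<Sum>y\<in>Y. y\<^sup>2 * (emeasure lborel (E y) + ennreal e))"
    proof (intro sum_mono mult_left_mono)
      fix y
      have "emeasure lborel (V y) = emeasure lborel (E y \<union> (V y - E y))"
        using V(2)[of y] by (intro arg_cong2[where f=emeasure]) auto
      also have "\<dots> \<le> emeasure lborel (E y) + emeasure lborel (V y - E y)"
        by (rule emeasure_subadditive) auto
      also have "\<dots> \<le> emeasure lborel (E y) + ennreal e"
        using V(3)[of y] by (intro add_left_mono) auto
      finally show "emeasure lborel (V y) \<le> emeasure lborel (E y) + ennreal e" .
    qed auto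
    also have "\<dots> = T + c * ennreal e"
    proof -
      have "T = (\<Sum>y\<in>Y. y\<^sup>2 * emeasure lborel (E y))"
        unfolding T_def s2 by (subst nn_integral_sum) (auto simp: nn_integral_cmult_indicator)
      then show ?thesis by (simp add: c_def distrib_left sum.distrib sum_distrib_right)
    qed
    finally show ?thesis by (simp add: mult_left_mono)
  qed
  have "(\<integral>\<^sup>+x. s x \<partial>\<theta>)\<^sup>2 \<le> ennreal K * T"
  proof (rule ennreal_le_epsilon)
    fix e :: real assume e: "0 < e"
    define c' where "c' = enn2real c"
    have c': "c = ennreal c'" "0 \<le> c'" using \<open>c < \<top>\<close> by (auto simp: c'_def)
    define e' where "e' = e / (K * c' + 1)"
    have e': "0 < e'" "K * c' * e' \<le> e"
      using e c'(2) \<open>0 \<le> K\<close> by (auto simp: e'_def field_simps add_pos_nonneg intro: divide_pos_pos)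
    have "(\<integral>\<^sup>+x. s x \<partial>\<theta>)\<^sup>2 \<le> ennreal K * T + ennreal (K * c' * e')"
      using bound[OF e'(1)] c' \<open>0 \<le> K\<close> e' by (simp add: distrib_left ennreal_mult mult.assoc)
    also have "\<dots> \<le> ennreal K * T + ennreal e" using e'(2) by (intro add_left_mono ennreal_leI)
    finally show "(\<integral>\<^sup>+x. s x \<partial>\<theta>)\<^sup>2 \<le> ennreal K * T + ennreal e" .
  qed
  then show ?thesis by (simp add: T_def)
qed

lemma L2_bound_of_energy:
  fixes \<theta> :: "real measure" and g :: "real \<Rightarrow> ennreal"
  assumes fin: "finite_measure \<theta>" and sets[measurable_cong]: "sets \<theta> = sets borel"
    and r: "\<And>m::nat. 0 < r m" "r \<longlonglongrightarrow> 0"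
    and energy: "\<And>m. closeness \<theta> 0 (2 * r m) \<le> ennreal (K * (2 * r m))" and "0 \<le> K"
    and [measurable]: "g \<in> borel_measurable borel"
  shows "(\<integral>\<^sup>+x. g x \<partial>\<theta>)\<^sup>2 \<le> ennreal K * (\<integral>\<^sup>+x. (g x)\<^sup>2 \<partial>lborel)"
proof -
  have "g \<in> borel_measurable lborel" by simp
  then obtain s where s: "\<And>i. simple_function lborel (s i)" "incseq s" "\<And>i x. s i x < \<top>"
    "\<And>x. (SUP i. s i x) = g x"
    using borel_measurable_implies_simple_function_sequence' by metis
  have [measurable]: "s i \<in> borel_measurable borel" for i
    using borel_measurable_simple_function[OF s(1)] by simp
  define C where "C = ennreal K * (\<integral>\<^sup>+x. (g x)\<^sup>2 \<partial>lborel)"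
  obtain B where B: "\<And>x::ennreal. x\<^sup>2 \<le> C \<longleftrightarrow> x \<le> B" using ennreal_ex_sqrt by metis
  have "(\<integral>\<^sup>+x. s i x \<partial>\<theta>) \<le> B" for i
  proof -
    have "(\<integral>\<^sup>+x. s i x \<partial>\<theta>)\<^sup>2 \<le> ennreal K * (\<integral>\<^sup>+x. (s i x)\<^sup>2 \<partial>lborel)"
      by (rule L2_bound_simple_function[OF sets \<open>0 \<le> K\<close> _ s(1) s(3)])
         (rule L2_bound_open_levels[OF fin sets r energy \<open>0 \<le> K\<close>])
    also have "\<dots> \<le> C"
      unfolding C_def s(4)[symmetric]
      by (intro mult_left_mono nn_integral_mono power_mono SUP_upper) auto
    finally show ?thesis by (simp add: B)
  qed
  moreover have "(\<integral>\<^sup>+x. g x \<partial>\<theta>) = (SUP i. \<integral>\<^sup>+x. s i x \<partial>\<theta>)"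
    unfolding s(4)[symmetric] by (rule nn_integral_monotone_convergence_SUP) (use s(2) in auto)
  ultimately have "(\<integral>\<^sup>+x. g x \<partial>\<theta>) \<le> B" by (auto intro: SUP_least)
  then show ?thesis by (simp add: C_def flip: B)
qed

text \<open>
  Null sets are handled by indicators. For the density \<open>F\<close>, the test function \<open>g = min F n\<close> satisfies
  \<open>\<integral>g\<^sup>2 \<le> \<integral>F g = \<integral>g \<partial>\<theta>\<close>, so the bound reads \<open>X\<^sup>2 \<le> K X\<close> for \<open>X = \<integral>g\<^sup>2\<close>. As \<open>X\<close> is finite, \<open>X \<le> K\<close>
  for every truncation level \<open>n\<close>.
\<close>

lemma L2_density_of_bound:
  fixes \<theta> :: "real measure"
  assumes fin: "finite_measure \<theta>" and sets: "sets \<theta> = sets borel"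
    and functional: "\<And>g :: real \<Rightarrow> ennreal. g \<in> borel_measurable borel \<Longrightarrow>
       (\<integral>\<^sup>+x. g x \<partial>\<theta>)\<^sup>2 \<le> ennreal K * (\<integral>\<^sup>+x. (g x)\<^sup>2 \<partial>lborel)"
  shows "absolutely_continuous lborel \<theta> \<and>
    (\<exists>f :: real \<Rightarrow> real. f \<in> borel_measurable borel \<and> (\<forall>x. f x \<ge> 0) \<and>
       \<theta> = density lborel (\<lambda>x. ennreal (f x)) \<and> integrable lborel (\<lambda>x. (f x)\<^sup>2))"
proof -
  interpret T: finite_measure \<theta> by fact
  have ac: "absolutely_continuous lborel \<theta>"
    unfolding absolutely_continuous_def
  proof safe
    fix N :: "real set" assume N: "N \<in> null_sets lborel"
    then have [measurable]: "N \<in> sets borel" by auto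
    have "(\<integral>\<^sup>+x. (indicator N x)\<^sup>2 \<partial>lborel) = (\<integral>\<^sup>+x. indicator N x \<partial>lborel :: ennreal)"
      by (intro nn_integral_cong) (auto split: split_indicator)
    also have "\<dots> = 0" using N by auto
    finally have "(emeasure \<theta> N)\<^sup>2 \<le> 0" using functional[of "indicator N"] sets by simp
    then show "N \<in> null_sets \<theta>" using sets by auto
  qed
  define F where "F = RN_deriv lborel \<theta>"
  have [measurable]: "F \<in> borel_measurable borel" unfolding F_def by simp
  have dens: "density lborel F = \<theta>"
    unfolding F_def by (rule sigma_finite_measure.density_RN_deriv[OF sigma_finite_lborel ac]) (simp add: sets)
  have F: "(\<integral>\<^sup>+x. g x \<partial>\<theta>) = (\<integral>\<^sup>+x. F x * g x \<partial>lborel)" if "g \<in> borel_measurable borel" for g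
    using that by (subst dens[symmetric]) (simp add: nn_integral_density)
  have F_int: "(\<integral>\<^sup>+x. F x \<partial>lborel) < \<top>"
    using F[of "\<lambda>_. 1"] T.emeasure_finite[of UNIV] sets_eq_imp_space_eq[OF sets]
    by (simp add: less_top)
  have trunc: "(\<integral>\<^sup>+x. (min (F x) (of_nat n))\<^sup>2 \<partial>lborel) \<le> ennreal K" for n :: nat
  proof -
    define g where "g x = min (F x) (of_nat n)" for x
    define X where "X = (\<integral>\<^sup>+x. (g x)\<^sup>2 \<partial>lborel)"
    have [measurable]: "g \<in> borel_measurable borel" unfolding g_def by measurable
    have "X \<le> (\<integral>\<^sup>+x. F x * g x \<partial>lborel)"
      unfolding X_def power2_eq_square by (intro nn_integral_mono mult_right_mono) (auto simp: g_def)
    also have "\<dots> = (\<integral>\<^sup>+x. g x \<partial>\<theta>)" by (simp add: F)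
    finally have X: "X \<le> (\<integral>\<^sup>+x. g x \<partial>\<theta>)" .
    also have "\<dots> \<le> (\<integral>\<^sup>+x. of_nat n \<partial>\<theta>)" by (intro nn_integral_mono) (simp add: g_def)
    also have "\<dots> < \<top>"
    proof -
      have "emeasure \<theta> (space \<theta>) < \<top>" by (metis T.emeasure_finite infinity_ennreal_def less_top)
      then show ?thesis by (simp add: ennreal_mult_less_top of_nat_less_top)
    qed
    finally have "X < \<top>" .
    have "X\<^sup>2 \<le> (\<integral>\<^sup>+x. g x \<partial>\<theta>)\<^sup>2" using X by (rule power_mono) simp
    also have "\<dots> \<le> ennreal K * X" unfolding X_def by (rule functional) measurable
    finally have "X * X \<le> ennreal K * X" by (simp add: power2_eq_square)
    then have "X \<le> ennreal K"
      using \<open>X < \<top>\<close> by (metis ennreal_mult_le_mult_iff less_irrefl mult.commute zero_le)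
    then show ?thesis by (simp add: X_def g_def)
  qed
  define f where "f x = enn2real (F x)" for x
  have [measurable]: "f \<in> borel_measurable borel" unfolding f_def by measurable
  have "AE x in lborel. F x \<noteq> \<infinity>"
    by (rule nn_integral_PInf_AE) (use F_int in auto)
  then have Ff: "AE x in lborel. F x = ennreal (f x)"
    by eventually_elim (auto simp: f_def less_top)
  have "\<theta> = density lborel (\<lambda>x. ennreal (f x))"
    unfolding dens[symmetric] by (rule density_cong) (use Ff in auto)
  moreover have "integrable lborel (\<lambda>x. (f x)\<^sup>2)"
  proof (rule integrableI_bounded)
    have "(\<integral>\<^sup>+x. (F x)\<^sup>2 \<partial>lborel) \<le> (\<integral>\<^sup>+x. liminf (\<lambda>n. (min (F x) (of_nat n))\<^sup>2) \<partial>lborel)"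
    proof (rule nn_integral_mono_AE)
      show "AE x in lborel. (F x)\<^sup>2 \<le> liminf (\<lambda>n. (min (F x) (of_nat n))\<^sup>2)"
        using Ff
      proof eventually_elim
        case (elim x)
        obtain N where N: "f x \<le> real N" using real_arch_simple by blast
        have "F x \<le> of_nat n" if "N \<le> n" for n
          using that N elim by (simp add: ennreal_leI flip: ennreal_of_nat_eq_real_of_nat)
        then have "\<forall>\<^sub>F n in sequentially. (F x)\<^sup>2 \<le> (min (F x) (of_nat n))\<^sup>2"
          by (intro eventually_sequentiallyI[of N]) (simp add: min_absorb1)
        then show ?case by (rule Liminf_bounded)
      qed
    qed
    also have "\<dots> \<le> liminf (\<lambda>n. \<integral>\<^sup>+x. (min (F x) (of_nat n))\<^sup>2 \<partial>lborel)"
      by (rule nn_integral_liminf) measurable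
    also have "\<dots> \<le> ennreal K"
      by (intro Liminf_le always_eventually allI trunc) simp
    also have "(\<integral>\<^sup>+x. (F x)\<^sup>2 \<partial>lborel) = (\<integral>\<^sup>+x. ennreal (norm ((f x)\<^sup>2)) \<partial>lborel)"
    proof (rule nn_integral_cong_AE)
      have "0 \<le> f x" for x by (simp add: f_def)
      then show "AE x in lborel. (F x)\<^sup>2 = ennreal (norm ((f x)\<^sup>2))"
        using Ff by (auto simp: ennreal_power elim!: eventually_mono)
    qed
    finally show "(\<integral>\<^sup>+x. ennreal (norm ((f x)\<^sup>2)) \<partial>lborel) < \<infinity>"
      by (metis ennreal_less_top infinity_ennreal_def le_less_trans)
  qed simp
  ultimately show ?thesis using ac by (intro conjI exI[of _ f]) (auto simp: f_def)
qed

section \<open>Closeness under transversality and convolution\<close>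

lemma closeness_le_frostman:
  assumes "prob_space M" and [measurable_cong]: "sets M = sets borel"
    and frostman: "\<And>x r. 0 < r \<Longrightarrow> measure M {x - r..x + r} \<le> C * r powr d"
    and "0 < r"
  shows "closeness M v r \<le> ennreal (C * r powr d)"
proof -
  interpret prob_space M by fact
  have "closeness M v r \<le> (\<integral>\<^sup>+x. ennreal (C * r powr d) \<partial>M)"
    unfolding closeness_def
    using frostman[OF \<open>0 < r\<close>]
    by (intro nn_integral_mono)
       (auto simp: nn_integral_indicator_interval assms(2) emeasure_eq_measure intro!: ennreal_leI)
  then show ?thesis by (simp add: emeasure_space_1)
qed

text \<open>
  After exchanging the integrals, a pair \<open>(x, y)\<close> contributes the measure of the parameters with
  \<open>\<bar>x - y + \<phi> t\<bar> \<le> r\<close>. This is at most \<open>c\<close>, and it vanishes unless \<open>\<bar>x - y\<bar> \<le> r + R\<close>.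
\<close>

lemma nn_integral_closeness_transversal:
  fixes M :: "real measure" and L :: "'t measure"
  assumes "finite_measure M" and [measurable_cong]: "sets M = sets borel"
    and "finite_measure L" and [measurable]: "\<phi> \<in> borel_measurable L"
    and bounded: "\<And>t. t \<in> space L \<Longrightarrow> \<bar>\<phi> t\<bar> \<le> R"
    and transversal: "\<And>v. emeasure L {t \<in> space L. \<bar>v + \<phi> t\<bar> \<le> r} \<le> c"
  shows "(\<integral>\<^sup>+t. closeness M (\<phi> t) r \<partial>L) \<le> c * closeness M 0 (r + R)"
proof -
  interpret M: finite_measure M by fact
  interpret L: finite_measure L by fact
  interpret pair_sigma_finite L M ..
  let ?I = "\<lambda>t x y. indicator {-r..r} (x - y + \<phi> t) :: ennreal"
  have "(\<integral>\<^sup>+t. closeness M (\<phi> t) r \<partial>L) = (\<integral>\<^sup>+x. \<integral>\<^sup>+t. \<integral>\<^sup>+y. ?I t x y \<partial>M \<partial>L \<partial>M)"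
    unfolding closeness_def by (rule Fubini'[symmetric]) measurable
  also have "\<dots> = (\<integral>\<^sup>+x. \<integral>\<^sup>+y. \<integral>\<^sup>+t. ?I t x y \<partial>L \<partial>M \<partial>M)"
    by (intro nn_integral_cong Fubini'[symmetric]) measurable
  also have "\<dots> \<le> (\<integral>\<^sup>+x. \<integral>\<^sup>+y. c * indicator {-(r + R)..r + R} (x - y + 0) \<partial>M \<partial>M)"
  proof (intro nn_integral_mono)
    fix x y
    show "(\<integral>\<^sup>+t. ?I t x y \<partial>L) \<le> c * indicator {-(r + R)..r + R} (x - y + 0)"
    proof (cases "\<bar>x - y\<bar> \<le> r + R")
      case True
      have "(\<integral>\<^sup>+t. ?I t x y \<partial>L) = (\<integral>\<^sup>+t. indicator {t \<in> space L. \<bar>x - y + \<phi> t\<bar> \<le> r} t \<partial>L)"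
        by (intro nn_integral_cong) (auto split: split_indicator)
      then show ?thesis using transversal[of "x - y"] True by (auto simp: abs_le_iff)
    next
      case False
      have "(\<integral>\<^sup>+t. ?I t x y \<partial>L) = (\<integral>\<^sup>+t. 0 \<partial>L)"
        using bounded False by (intro nn_integral_cong) (fastforce split: split_indicator)
      then show ?thesis by simp
    qed
  qed
  also have "\<dots> = c * closeness M 0 (r + R)"
    unfolding closeness_def by (simp add: nn_integral_cmult)
  finally show ?thesis .
qed

lemma finite_measure_density_indicator:
  assumes "finite_measure N" "S \<in> sets N"
  shows "finite_measure (density N (indicator S))"
proof -
  interpret finite_measure N by fact
  show ?thesis
    using assms(2) by (intro finite_measureI) (simp add: emeasure_density emeasure_finite)
qed

lemma nn_integral_convolution_piece:
  fixes M :: "real measure" and g :: "real \<Rightarrow> ennreal"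
  assumes "finite_measure M" and sM[measurable_cong]: "sets M = sets borel"
    and "finite_measure N" and [measurable]: "S \<in> sets N" "X \<in> borel_measurable N"
      "g \<in> borel_measurable borel"
  shows "(\<integral>\<^sup>+z. g z \<partial>(M \<star> distr (density N (indicator S)) borel X))
    = (\<integral>\<^sup>+x. \<integral>\<^sup>+\<omega>. indicator S \<omega> * g (x + X \<omega>) \<partial>N \<partial>M)"
proof -
  interpret finite_measure "density N (indicator S)"
    using assms by (intro finite_measure_density_indicator)
  have "finite_measure (distr (density N (indicator S)) borel X)"
    by (rule finite_measure_distr) simp
  then have "(\<integral>\<^sup>+z. g z \<partial>(M \<star> distr (density N (indicator S)) borel X))
      = (\<integral>\<^sup>+x. \<integral>\<^sup>+y. g (x + y) \<partial>distr (density N (indicator S)) borel X \<partial>M)"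
    using assms by (intro nn_integral_convolution) auto
  then show ?thesis by (simp add: nn_integral_distr nn_integral_density)
qed

text \<open>
  Moving each of two values of \<open>X\<close> to its nearby atom \<open>p u\<close> changes their difference by at most
  \<open>2 \<delta>\<close>, so distance \<open>\<delta>\<close> becomes \<open>3 \<delta>\<close>. If \<open>X\<close> depends on a parameter, the
  finite sum depends on it only through the differences of atoms, so its measurability in the parameter
  needs no joint measurability of \<open>X\<close>.
\<close>

lemma closeness_convolution_le_sum:
  fixes M :: "real measure" and B :: "'i \<Rightarrow> 'b set"
  assumes "finite_measure M" and sM[measurable_cong]: "sets M = sets borel"
    and "finite_measure N" and [measurable]: "X \<in> borel_measurable N"
    and "finite U" and B: "\<And>u. u \<in> U \<Longrightarrow> B u \<in> sets N"
    and near: "\<And>u \<omega>. u \<in> U \<Longrightarrow> \<omega> \<in> B u \<Longrightarrow> \<bar>X \<omega> - p u\<bar> \<le> \<delta>"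
  shows "closeness (M \<star> distr (density N (indicator (\<Union>u\<in>U. B u))) borel X) 0 \<delta>
    \<le> (\<Sum>u\<in>U. \<Sum>u'\<in>U. emeasure N (B u) * emeasure N (B u') * closeness M (p u - p u') (3 * \<delta>))"
proof -
  interpret M: finite_measure M by fact
  interpret N: finite_measure N by fact
  define S where "S = (\<Union>u\<in>U. B u)"
  have [measurable]: "S \<in> sets N" unfolding S_def using \<open>finite U\<close> B by auto
  define \<theta> where "\<theta> = (M \<star> distr (density N (indicator S)) borel X)"
  have int: "(\<integral>\<^sup>+z. g z \<partial>\<theta>) = (\<integral>\<^sup>+x. \<integral>\<^sup>+\<omega>. indicator S \<omega> * g (x + X \<omega>) \<partial>N \<partial>M)"
    if "g \<in> borel_measurable borel" for g
    unfolding \<theta>_def using that assms(1-4) by (intro nn_integral_convolution_piece) auto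
  have cover: "indicator S \<omega> \<le> (\<Sum>u\<in>U. indicator (B u) \<omega> :: ennreal)" for \<omega>
  proof (cases "\<omega> \<in> S")
    case True
    then obtain u where "u \<in> U" "\<omega> \<in> B u" by (auto simp: S_def)
    then show ?thesis
      using member_le_sum[of u U "\<lambda>u. indicator (B u) \<omega> :: ennreal"] \<open>finite U\<close> True by simp
  qed simp
  define H where "H u x = (\<Sum>u'\<in>U. emeasure N (B u') *
    (\<integral>\<^sup>+x'. indicator {-(3 * \<delta>)..3 * \<delta>} (x - x' + (p u - p u')) \<partial>M))" for u x
  have [measurable]: "H u \<in> borel_measurable borel" for u unfolding H_def by measurable
  have inner: "(\<integral>\<^sup>+y. indicator {-\<delta>..\<delta>} (x + X \<omega> - y + 0) \<partial>\<theta>) \<le> H u x"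
    if u: "u \<in> U" "\<omega> \<in> B u" for u \<omega> x
  proof -
    have "(\<integral>\<^sup>+y. indicator {-\<delta>..\<delta>} (x + X \<omega> - y + 0) \<partial>\<theta>)
        = (\<integral>\<^sup>+x'. \<integral>\<^sup>+\<tau>. indicator S \<tau> * indicator {-\<delta>..\<delta>} (x + X \<omega> - (x' + X \<tau>) + 0) \<partial>N \<partial>M)"
      by (rule int) measurable
    also have "\<dots> \<le> (\<integral>\<^sup>+x'. \<integral>\<^sup>+\<tau>. (\<Sum>u'\<in>U. indicator {-(3 * \<delta>)..3 * \<delta>} (x - x' + (p u - p u'))
        * indicator (B u') \<tau>) \<partial>N \<partial>M)"
    proof (intro nn_integral_mono)
      fix x' \<tau>
      show "indicator S \<tau> * indicator {-\<delta>..\<delta>} (x + X \<omega> - (x' + X \<tau>) + 0)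
        \<le> (\<Sum>u'\<in>U. indicator {-(3 * \<delta>)..3 * \<delta>} (x - x' + (p u - p u')) * indicator (B u') \<tau> :: ennreal)"
      proof (cases "\<tau> \<in> S \<and> \<bar>x + X \<omega> - (x' + X \<tau>)\<bar> \<le> \<delta>")
        case True
        then obtain u' where u': "u' \<in> U" "\<tau> \<in> B u'" by (auto simp: S_def)
        have "\<bar>x - x' + (p u - p u')\<bar> \<le> 3 * \<delta>"
          using near[OF u] near[OF u'] True by linarith
        then have "1 \<le> (indicator {-(3 * \<delta>)..3 * \<delta>} (x - x' + (p u - p u')) * indicator (B u') \<tau> :: ennreal)"
          using u' by (auto simp: abs_le_iff)
        also have "\<dots> \<le> (\<Sum>u'\<in>U. indicator {-(3 * \<delta>)..3 * \<delta>} (x - x' + (p u - p u')) * indicator (B u') \<tau>)"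
          using u'(1) \<open>finite U\<close> by (intro member_le_sum) auto
        finally show ?thesis by (rule order_trans[rotated]) (auto split: split_indicator)
      qed (auto split: split_indicator)
    qed
    also have "\<dots> = (\<integral>\<^sup>+x'. (\<Sum>u'\<in>U. emeasure N (B u')
        * indicator {-(3 * \<delta>)..3 * \<delta>} (x - x' + (p u - p u'))) \<partial>M)"
      using B by (intro nn_integral_cong) (simp add: nn_integral_sum nn_integral_multc mult.commute)
    also have "\<dots> = H u x"
      unfolding H_def by (simp add: nn_integral_sum nn_integral_cmult)
    finally show ?thesis .
  qed
  have "closeness \<theta> 0 \<delta>
      = (\<integral>\<^sup>+x. \<integral>\<^sup>+\<omega>. indicator S \<omega> * (\<integral>\<^sup>+y. indicator {-\<delta>..\<delta>} (x + X \<omega> - y + 0) \<partial>\<theta>) \<partial>N \<partial>M)"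
    unfolding closeness_def
  proof (rule int)
    have [measurable_cong]: "sets \<theta> = sets borel" by (simp add: \<theta>_def)
    interpret T: finite_measure \<theta>
      unfolding \<theta>_def using assms(1-3)
      by (intro convolution_finite finite_measure.finite_measure_distr
          finite_measure_density_indicator) auto
    show "(\<lambda>z. \<integral>\<^sup>+y. indicator {-\<delta>..\<delta>} (z - y + 0) \<partial>\<theta>) \<in> borel_measurable borel"
      by measurable
  qed
  also have "\<dots> \<le> (\<integral>\<^sup>+x. \<integral>\<^sup>+\<omega>. (\<Sum>u\<in>U. H u x * indicator (B u) \<omega>) \<partial>N \<partial>M)"
  proof (intro nn_integral_mono)
    fix x \<omega>
    let ?E = "\<integral>\<^sup>+y. indicator {-\<delta>..\<delta>} (x + X \<omega> - y + 0) \<partial>\<theta>"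
    have "indicator S \<omega> * ?E \<le> (\<Sum>u\<in>U. indicator (B u) \<omega>) * ?E"
      by (intro mult_right_mono cover) auto
    also have "\<dots> = (\<Sum>u\<in>U. indicator (B u) \<omega> * ?E)" by (rule sum_distrib_right)
    also have "\<dots> \<le> (\<Sum>u\<in>U. H u x * indicator (B u) \<omega>)"
      by (intro sum_mono) (use inner in \<open>auto split: split_indicator\<close>)
    finally show "indicator S \<omega> * ?E \<le> (\<Sum>u\<in>U. H u x * indicator (B u) \<omega>)" .
  qed
  also have "\<dots> = (\<integral>\<^sup>+x. (\<Sum>u\<in>U. H u x * emeasure N (B u)) \<partial>M)"
    using B by (intro nn_integral_cong) (simp add: nn_integral_sum nn_integral_cmult)
  also have "\<dots> = (\<Sum>u\<in>U. (\<integral>\<^sup>+x. H u x \<partial>M) * emeasure N (B u))"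
    by (subst nn_integral_sum) (auto simp: nn_integral_multc)
  also have "\<dots> = (\<Sum>u\<in>U. \<Sum>u'\<in>U. emeasure N (B u) * emeasure N (B u') * closeness M (p u - p u') (3 * \<delta>))"
    unfolding H_def closeness_def
    by (intro sum.cong refl, subst nn_integral_sum)
       (auto simp: nn_integral_cmult sum_distrib_right sum_distrib_left mult_ac)
  finally show ?thesis by (simp add: \<theta>_def S_def)
qed

section \<open>Bounds for a single pair and summation over pairs\<close>

text \<open>
  If \<open>\<rho> \<le> b powr (- \<alpha> k)\<close>, the second bound alone gives the first summand. Otherwise the two bounds
  together read \<open>x \<le> K \<rho> powr d * min 1 w\<close> with \<open>w = b powr (k \<beta>) * \<rho>\<close>, and \<open>min 1 w \<le> w powr s\<close> for
  \<open>s\<close> in \<open>[0, 1]\<close>; the condition \<open>1 \<le> d + s\<close> keeps a full factor \<open>\<rho>\<close>.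
\<close>

lemma transversal_scale_bound:
  fixes x b \<rho> :: real
  assumes b: "1 < b" and \<rho>: "0 < \<rho>" "\<rho> \<le> 1" and d: "0 \<le> d" and s: "0 \<le> s" "s \<le> 1" "1 \<le> d + s"
    and C: "0 \<le> C" "0 \<le> D1" "0 \<le> D2"
    and trivial: "x \<le> D1 * \<rho> powr d"
    and transversal: "x \<le> D2 * b powr (k * \<beta>) * \<rho> * (\<rho> + C * b powr (- \<alpha> * k)) powr d"
  shows "x \<le> max D1 (D2 * (1 + C) powr d) * \<rho> * (b powr (k * (\<beta> - \<alpha> * d)) + b powr (k * \<beta> * s))"
proof -
  define K where "K = max D1 (D2 * (1 + C) powr d)"
  define y where "y = b powr (- \<alpha> * k)"
  define z where "z = b powr (k * \<beta>)"
  have pos: "0 < y" "0 < z" using b by (auto simp: y_def z_def)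
  have K: "D1 \<le> K" "D2 * (1 + C) powr d \<le> K" "0 \<le> K" using C by (auto simp: K_def)
  show ?thesis
  proof (cases "\<rho> \<le> y")
    case True
    have "(\<rho> + C * y) powr d \<le> ((1 + C) * y) powr d"
      using True C pos \<rho> d by (intro powr_mono2) (auto simp: algebra_simps)
    also have "\<dots> = (1 + C) powr d * y powr d" using C pos by (simp add: powr_mult)
    finally have "D2 * z * \<rho> * (\<rho> + C * y) powr d \<le> D2 * z * \<rho> * ((1 + C) powr d * y powr d)"
      using C pos \<rho> by (intro mult_left_mono) auto
    also have "\<dots> = (D2 * (1 + C) powr d) * (\<rho> * (z * y powr d))" by (simp add: mult_ac)
    also have "\<dots> \<le> K * (\<rho> * (z * y powr d))"
      using K pos \<rho> by (intro mult_right_mono) auto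
    also have "z * y powr d = b powr (k * (\<beta> - \<alpha> * d))"
      by (simp add: z_def y_def powr_powr algebra_simps flip: powr_add)
    also have "K * (\<rho> * b powr (k * (\<beta> - \<alpha> * d)))
        \<le> K * \<rho> * (b powr (k * (\<beta> - \<alpha> * d)) + b powr (k * \<beta> * s))"
      using K \<rho> by (simp add: distrib_left mult.assoc)
    finally show ?thesis using transversal by (simp add: K_def y_def z_def)
  next
    case False
    define w where "w = z * \<rho>"
    have w: "0 < w" using pos \<rho> by (simp add: w_def)
    have "(\<rho> + C * y) powr d \<le> ((1 + C) * \<rho>) powr d"
      using False C pos \<rho> d by (intro powr_mono2) (auto simp: algebra_simps intro!: mult_left_mono)
    also have "\<dots> = (1 + C) powr d * \<rho> powr d" using C \<rho> by (simp add: powr_mult)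
    finally have "D2 * z * \<rho> * (\<rho> + C * y) powr d \<le> D2 * z * \<rho> * ((1 + C) powr d * \<rho> powr d)"
      using C pos \<rho> by (intro mult_left_mono) auto
    also have "\<dots> = (D2 * (1 + C) powr d) * (\<rho> powr d * w)" by (simp add: mult_ac w_def)
    also have "\<dots> \<le> K * (\<rho> powr d * w)" using K w by (intro mult_right_mono) auto
    finally have 1: "x \<le> K * \<rho> powr d * w" using transversal by (simp add: y_def z_def mult.assoc)
    have 2: "x \<le> K * \<rho> powr d * 1"
      using trivial mult_right_mono[OF K(1), of "\<rho> powr d"] by simp
    have "x \<le> K * \<rho> powr d * min w 1"
      using 1 2 by (simp add: min_def)
    also have "min w 1 \<le> w powr s"
    proof (cases "w \<le> 1")
      case True
      then have "w powr 1 \<le> w powr s" using w s by (intro powr_mono') auto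
      then show ?thesis using w True by simp
    next
      case False
      then show ?thesis using s by (simp add: ge_one_powr_ge_zero)
    qed
    finally have "x \<le> K * (\<rho> powr d * w powr s)" using K by (simp add: mult_left_mono mult.assoc)
    also have "\<rho> powr d * w powr s = \<rho> powr (d + s) * z powr s"
      using pos \<rho> by (simp add: w_def powr_mult powr_add)
    also have "\<dots> \<le> \<rho> powr 1 * z powr s"
      using \<rho> s by (intro mult_right_mono powr_mono') auto
    also have "\<dots> = \<rho> * b powr (k * \<beta> * s)" using \<rho> by (simp add: z_def powr_powr)
    finally have "x \<le> K * (\<rho> * b powr (k * \<beta> * s))" using K by (simp add: mult_left_mono)
    also have "\<dots> \<le> K * \<rho> * (b powr (k * (\<beta> - \<alpha> * d)) + b powr (k * \<beta> * s))"
      using K \<rho> by (simp add: distrib_left mult.assoc)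
    finally show ?thesis by (simp add: K_def)
  qed
qed

text \<open>
  For each \<open>u\<close> the remaining indices are grouped by the level that they share with \<open>u\<close>.
\<close>

lemma sum_pairs_by_level:
  fixes m :: "'u \<Rightarrow> real" and lev :: "'u \<Rightarrow> 'u \<Rightarrow> nat"
  assumes "finite U" and m: "\<And>u. u \<in> U \<Longrightarrow> 0 \<le> m u" "\<And>u. u \<in> U \<Longrightarrow> m u \<le> \<epsilon>" "sum m U \<le> 1"
    and lev: "\<And>u u'. u \<in> U \<Longrightarrow> u' \<in> U \<Longrightarrow> u \<noteq> u' \<Longrightarrow> lev u u' < n"
    and mass: "\<And>u k. u \<in> U \<Longrightarrow> k < n \<Longrightarrow> sum m {u' \<in> U. u' \<noteq> u \<and> lev u u' = k} \<le> G k"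
    and F: "\<And>k. 0 \<le> F k" and D: "0 \<le> D" and G: "\<And>k. 0 \<le> G k" and "0 \<le> \<epsilon>"
  shows "(\<Sum>u\<in>U. \<Sum>u'\<in>U. m u * m u' * (if u = u' then D else F (lev u u')))
    \<le> \<epsilon> * D + (\<Sum>k<n. G k * F k)"
proof -
  have row: "(\<Sum>u'\<in>U. m u' * (if u = u' then D else F (lev u u'))) \<le> \<epsilon> * D + (\<Sum>k<n. G k * F k)"
    if u: "u \<in> U" for u
  proof -
    let ?U = "{u' \<in> U. u' \<noteq> u}"
    have "(\<Sum>u'\<in>U. m u' * (if u = u' then D else F (lev u u')))
        = m u * D + (\<Sum>u'\<in>?U. m u' * F (lev u u'))"
    proof -
      have "U = insert u ?U" using u by auto
      then have "(\<Sum>u'\<in>U. m u' * (if u = u' then D else F (lev u u')))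
          = (\<Sum>u'\<in>insert u ?U. m u' * (if u = u' then D else F (lev u u')))" by simp
      also have "\<dots> = m u * D + (\<Sum>u'\<in>?U. m u' * (if u = u' then D else F (lev u u')))"
        using \<open>finite U\<close> by simp
      also have "(\<Sum>u'\<in>?U. m u' * (if u = u' then D else F (lev u u'))) = (\<Sum>u'\<in>?U. m u' * F (lev u u'))"
        by (intro sum.cong) auto
      finally show ?thesis .
    qed
    also have "(\<Sum>u'\<in>?U. m u' * F (lev u u'))
        = (\<Sum>k<n. \<Sum>u'\<in>{u' \<in> ?U. lev u u' = k}. m u' * F (lev u u'))"
      using \<open>finite U\<close> lev u by (intro sum.group[symmetric]) auto
    also have "\<dots> = (\<Sum>k<n. sum m {u' \<in> U. u' \<noteq> u \<and> lev u u' = k} * F k)"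
      by (intro sum.cong refl) (auto simp: sum_distrib_right intro!: sum.cong)
    also have "\<dots> \<le> (\<Sum>k<n. G k * F k)"
      using mass[OF u] F by (intro sum_mono mult_right_mono) auto
    finally show ?thesis using mult_right_mono[OF m(2)[OF u] D] by linarith
  qed
  let ?S = "\<epsilon> * D + (\<Sum>k<n. G k * F k)"
  have "0 \<le> ?S" using F D G \<open>0 \<le> \<epsilon>\<close> by (auto intro!: add_nonneg_nonneg sum_nonneg)
  have "(\<Sum>u\<in>U. \<Sum>u'\<in>U. m u * m u' * (if u = u' then D else F (lev u u'))) \<le> (\<Sum>u\<in>U. m u * ?S)"
    using row m(1) by (auto simp: mult.assoc simp flip: sum_distrib_left intro!: sum_mono mult_left_mono)
  also have "\<dots> = sum m U * ?S" by (simp add: sum_distrib_right)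
  also have "\<dots> \<le> 1 * ?S" using m(3) \<open>0 \<le> ?S\<close> by (rule mult_right_mono)
  finally show ?thesis by simp
qed

lemma sum_power_le_geometric:
  fixes q :: real
  assumes "0 \<le> q" "q < 1"
  shows "(\<Sum>k<n. q ^ k) \<le> 1 / (1 - q)"
  using assms by (simp add: sum_gp_strict divide_right_mono)

section \<open>Cylinders of a topological Markov chain\<close>

lemma cylinder_iff:
  "\<omega> \<in> cylinder A u \<longleftrightarrow> \<omega> \<in> markov_chain A \<and> (\<forall>i<length u. \<omega> i = u ! i)"
  unfolding cylinder_def mem_Collect_eq list_eq_iff_nth_eq by simp

lemma common_prefix_length_props:
  assumes "\<omega> \<noteq> \<tau>"
  shows agree_below_common_prefix: "\<And>i. i < common_prefix_length \<omega> \<tau> \<Longrightarrow> \<omega> i = \<tau> i"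
    and common_prefix_length_le: "\<And>i. \<omega> i \<noteq> \<tau> i \<Longrightarrow> common_prefix_length \<omega> \<tau> \<le> i"
    and common_prefix_length_ge: "\<And>n. (\<And>i. i < n \<Longrightarrow> \<omega> i = \<tau> i) \<Longrightarrow> n \<le> common_prefix_length \<omega> \<tau>"
proof -
  obtain j where j: "\<omega> j \<noteq> \<tau> j" using assms by (auto simp: fun_eq_iff)
  show "\<omega> i = \<tau> i" if "i < common_prefix_length \<omega> \<tau>" for i
    using not_less_Least that unfolding common_prefix_length_def by blast
  show "common_prefix_length \<omega> \<tau> \<le> i" if "\<omega> i \<noteq> \<tau> i" for i
    unfolding common_prefix_length_def using that by (rule Least_le)
  show "n \<le> common_prefix_length \<omega> \<tau>" if "\<And>i. i < n \<Longrightarrow> \<omega> i = \<tau> i" for n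
    unfolding common_prefix_length_def using LeastI[of "\<lambda>n. \<omega> n \<noteq> \<tau> n", OF j] that by (meson not_le)
qed

lemma cylinder_in_sets:
  fixes A :: "real^('a::{finite, discrete_topology})^('a::{finite, discrete_topology})"
  shows "cylinder A u \<in> sets (restrict_space borel (markov_chain A))"
proof -
  have "open {\<omega> :: nat \<Rightarrow> 'a. \<omega> i = a}" for i a
  proof -
    have "continuous_on UNIV (\<lambda>\<omega> :: nat \<Rightarrow> 'a. \<omega> i)" by (rule continuous_on_product_coordinates)
    then have "open ((\<lambda>\<omega> :: nat \<Rightarrow> 'a. \<omega> i) -` {a})"
      by (rule open_vimage[rotated]) (rule discrete_topology_class.open_discrete)
    then show ?thesis by (simp add: vimage_def)
  qed
  then have "open (\<Inter>i<length u. {\<omega> :: nat \<Rightarrow> 'a. \<omega> i = u ! i})" by (intro open_INT) auto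
  then have "(\<Inter>i<length u. {\<omega> :: nat \<Rightarrow> 'a. \<omega> i = u ! i}) \<in> sets borel" by simp
  moreover have "cylinder A u = markov_chain A \<inter> (\<Inter>i<length u. {\<omega>. \<omega> i = u ! i})"
    by (auto simp: cylinder_iff)
  ultimately show ?thesis by (auto simp: sets_restrict_space)
qed

section \<open>Transversal families of projections\<close>

text \<open>
  The base \<open>b\<close> of the exponential rates may be any real number above \<open>1\<close>; for the theorem it is the
  size of the alphabet.
\<close>

locale transversal_projections =
  fixes A :: "real^('a::{finite, discrete_topology})^('a::{finite, discrete_topology})"
    and \<mu> :: "(nat \<Rightarrow> 'a) measure"
    and P :: "real \<Rightarrow> (nat \<Rightarrow> 'a) \<Rightarrow> real"
    and \<eta> :: "real measure"
    and l0 l1 C1 C2 C3 C4 \<alpha> \<beta> \<gamma> d b :: real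
    and k0 :: nat
  assumes base: "1 < b"
    and mu: "prob_space \<mu>" and sets_mu: "sets \<mu> = sets (restrict_space borel (markov_chain A))"
    and interval: "l0 \<le> l1"
    and P_cont: "\<And>t. t \<in> {l0..l1} \<Longrightarrow> continuous_on (markov_chain A) (P t)"
    and constants: "C1 > 0" "C2 > 0" "C3 > 0" "C4 > 0" "\<alpha> > 0" "\<beta> > 0" "\<gamma> > 0"
    and phi_bound:
      "\<And>\<omega> \<tau> t. \<omega> \<in> markov_chain A \<Longrightarrow> \<tau> \<in> markov_chain A \<Longrightarrow> \<omega> \<noteq> \<tau> \<Longrightarrow> t \<in> {l0..l1} \<Longrightarrow>
         \<bar>phi P \<omega> \<tau> t\<bar> \<le> C1 * b powr (- \<alpha> * real (common_prefix_length \<omega> \<tau>))"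
    and level_sets_measurable:
      "\<And>\<omega> \<tau> v r. \<omega> \<in> markov_chain A \<Longrightarrow> \<tau> \<in> markov_chain A \<Longrightarrow> \<omega> \<noteq> \<tau> \<Longrightarrow>
         common_prefix_length \<omega> \<tau> \<ge> k0 \<Longrightarrow> r > 0 \<Longrightarrow>
         {t \<in> {l0..l1}. \<bar>v + phi P \<omega> \<tau> t\<bar> \<le> r} \<in> sets lebesgue"
    and transversality:
      "\<And>\<omega> \<tau> v r. \<omega> \<in> markov_chain A \<Longrightarrow> \<tau> \<in> markov_chain A \<Longrightarrow> \<omega> \<noteq> \<tau> \<Longrightarrow>
         common_prefix_length \<omega> \<tau> \<ge> k0 \<Longrightarrow> r > 0 \<Longrightarrow>
         emeasure lebesgue {t \<in> {l0..l1}. \<bar>v + phi P \<omega> \<tau> t\<bar> \<le> r}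
           \<le> ennreal (C2 * b powr (real (common_prefix_length \<omega> \<tau>) * \<beta>) * r)"
    and mu_cylinder:
      "\<And>u. 1 \<le> length u \<Longrightarrow> measure \<mu> (cylinder A u) \<le> C3 * b powr (- \<gamma> * real (length u))"
    and eta: "prob_space \<eta>" "sets \<eta> = sets borel"
    and d_nonneg: "d \<ge> 0"
    and eta_frostman: "\<And>x r. r > 0 \<Longrightarrow> measure \<eta> {x - r..x + r} \<le> C4 * r powr d"
    and dimension: "d + \<gamma> / \<beta> > 1" "d > (\<beta> - \<gamma>) / \<alpha>"
begin

sublocale mu: prob_space \<mu> by (fact mu)
sublocale eta: prob_space \<eta> by (fact eta(1))

abbreviation J :: "real measure" where "J \<equiv> lebesgue_on {l0..l1}"

lemma emeasure_J: "emeasure J (space J) = ennreal (l1 - l0)"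
  using interval by (simp add: emeasure_restrict_space space_restrict_space)

lemma finite_J: "finite_measure J"
  by (rule finite_measureI) (unfold emeasure_J, simp)

lemma space_mu: "space \<mu> = markov_chain A"
proof -
  have "space \<mu> = space (restrict_space borel (markov_chain A))"
    by (rule sets_eq_imp_space_eq[OF sets_mu])
  then show ?thesis by (simp only: space_restrict_space space_borel Int_UNIV_right)
qed

lemma cylinder_measurable [measurable, simp]: "cylinder A u \<in> sets \<mu>"
  by (simp only: sets_mu cylinder_in_sets)

lemma P_measurable:
  assumes "t \<in> {l0..l1}"
  shows "P t \<in> borel_measurable \<mu>"
proof -
  have "P t \<in> borel_measurable (restrict_space borel (markov_chain A))"
    by (rule borel_measurable_continuous_on_restrict[OF P_cont[OF assms]])
  then show ?thesis by (simp only: measurable_cong_sets[OF sets_mu refl])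
qed

text \<open>
  Every half line is a countable union of compact intervals, and the preimages of compact intervals are
  the level sets in the transversality condition.
\<close>

lemma phi_measurable:
  assumes \<omega>: "\<omega> \<in> markov_chain A" "\<tau> \<in> markov_chain A" "\<omega> \<noteq> \<tau>" "k0 \<le> common_prefix_length \<omega> \<tau>"
  shows "phi P \<omega> \<tau> \<in> borel_measurable J"
proof (rule borel_measurableI_le)
  fix c :: real
  have "{t \<in> {l0..l1}. phi P \<omega> \<tau> t \<le> c}
      = (\<Union>j::nat. {t \<in> {l0..l1}. \<bar>(real j + 1 - c) + phi P \<omega> \<tau> t\<bar> \<le> real j + 1})" (is "?L = ?R")
  proof safe
    fix t assume t: "t \<in> {l0..l1}" "phi P \<omega> \<tau> t \<le> c"
    obtain j :: nat where "\<bar>c - phi P \<omega> \<tau> t\<bar> \<le> real j" using real_arch_simple by blast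
    then show "t \<in> ?R" using t by (intro UN_I[of j]) auto
  qed auto
  moreover have "{t \<in> {l0..l1}. \<bar>(real j + 1 - c) + phi P \<omega> \<tau> t\<bar> \<le> real j + 1} \<in> sets lebesgue" for j :: nat
    by (rule level_sets_measurable[OF \<omega>]) simp
  then have "?R \<in> sets lebesgue" by (intro sets.countable_UN) blast
  ultimately have L: "?L \<in> sets lebesgue" by (simp only:)
  have "?L \<in> sets J"
    by (subst sets_restrict_space_iff) (use L in auto)
  moreover have "{t \<in> space J. phi P \<omega> \<tau> t \<le> c} = ?L" by (simp add: space_restrict_space)
  ultimately show "{t \<in> space J. phi P \<omega> \<tau> t \<le> c} \<in> sets J" by (simp only:)
qed

text \<open>
  The exponent \<open>interp_exp\<close> is the smallest nonnegative \<open>s\<close> with \<open>1 \<le> d + s\<close>, which leaves the most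
  room in the requirement \<open>\<beta> s < \<gamma>\<close>.
\<close>

definition "interp_exp = max 0 (1 - d)"
definition "pair_const = max (C4 * (l1 - l0)) (C2 * C4 * (1 + C1) powr d)"
definition level_energy :: "nat \<Rightarrow> real" where
  "level_energy k = b powr (k * (\<beta> - \<alpha> * d)) + b powr (k * \<beta> * interp_exp)"

lemma pair_const_nonneg: "0 \<le> pair_const"
proof -
  have "0 \<le> C4 * (l1 - l0)" using constants(4) interval by simp
  then show ?thesis unfolding pair_const_def by (rule max.coboundedI1)
qed

lemma level_energy_nonneg: "0 \<le> level_energy k" by (simp add: level_energy_def)

lemma pair_energy:
  assumes \<omega>: "\<omega> \<in> markov_chain A" "\<tau> \<in> markov_chain A" "\<omega> \<noteq> \<tau>" "k0 \<le> common_prefix_length \<omega> \<tau>"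
    and \<rho>: "0 < \<rho>" "\<rho> \<le> 1"
  shows "(\<integral>\<^sup>+t. closeness \<eta> (phi P \<omega> \<tau> t) \<rho> \<partial>J) \<le> ennreal (pair_const * \<rho> * level_energy (common_prefix_length \<omega> \<tau>))"
proof -
  let ?k = "real (common_prefix_length \<omega> \<tau>)"
  let ?R = "C1 * b powr (- \<alpha> * ?k)"
  let ?X = "\<integral>\<^sup>+t. closeness \<eta> (phi P \<omega> \<tau> t) \<rho> \<partial>J"
  have frostman: "closeness \<eta> v r \<le> ennreal (C4 * r powr d)" if "0 < r" for v r
    using closeness_le_frostman[OF eta(1,2) eta_frostman that] by simp
  have "?X \<le> (\<integral>\<^sup>+t. ennreal (C4 * \<rho> powr d) \<partial>J)"
    by (intro nn_integral_mono frostman \<rho>)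
  also have "\<dots> = ennreal (C4 * (l1 - l0) * \<rho> powr d)"
    unfolding nn_integral_const emeasure_J
    using constants interval by (subst ennreal_mult[symmetric]) (auto simp: mult_ac)
  finally have 1: "?X \<le> ennreal (C4 * (l1 - l0) * \<rho> powr d)" .
  have "?X \<le> ennreal (C2 * b powr (?k * \<beta>) * \<rho>) * closeness \<eta> 0 (\<rho> + ?R)"
  proof (rule nn_integral_closeness_transversal[OF eta.finite_measure_axioms eta(2) finite_J phi_measurable[OF \<omega>]])
    show "\<bar>phi P \<omega> \<tau> t\<bar> \<le> ?R" if "t \<in> space J" for t
      using phi_bound[OF \<omega>(1-3)] that by (simp add: space_restrict_space)
    show "emeasure J {t \<in> space J. \<bar>v + phi P \<omega> \<tau> t\<bar> \<le> \<rho>} \<le> ennreal (C2 * b powr (?k * \<beta>) * \<rho>)" for v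
    proof -
      let ?S = "{t \<in> {l0..l1}. \<bar>v + phi P \<omega> \<tau> t\<bar> \<le> \<rho>}"
      have "emeasure J ?S = emeasure lebesgue ?S" by (rule emeasure_restrict_space) auto
      then show ?thesis
        using transversality[OF \<omega> \<rho>(1), of v] by (simp only: space_lebesgue_on)
    qed
  qed
  also have "\<dots> \<le> ennreal (C2 * b powr (?k * \<beta>) * \<rho>) * ennreal (C4 * (\<rho> + ?R) powr d)"
    using \<rho> constants base by (intro mult_left_mono frostman) (auto intro: add_pos_nonneg)
  also have "\<dots> = ennreal ((C2 * C4) * b powr (?k * \<beta>) * \<rho> * (\<rho> + ?R) powr d)"
    using \<rho> constants by (subst ennreal_mult[symmetric]) (auto simp: mult_ac)
  finally have 2: "?X \<le> ennreal ((C2 * C4) * b powr (?k * \<beta>) * \<rho> * (\<rho> + ?R) powr d)" .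
  let ?x = "min (C4 * (l1 - l0) * \<rho> powr d) ((C2 * C4) * b powr (?k * \<beta>) * \<rho> * (\<rho> + ?R) powr d)"
  have "?X \<le> ennreal ?x" using 1 2 by (auto simp: min_def)
  also have "\<dots> \<le> ennreal (pair_const * \<rho> * level_energy (common_prefix_length \<omega> \<tau>))"
    unfolding pair_const_def level_energy_def
  proof (rule ennreal_leI, rule transversal_scale_bound[where \<alpha>=\<alpha>])
    show "interp_exp \<le> 1" "0 \<le> interp_exp" "1 \<le> d + interp_exp" using d_nonneg by (auto simp: interp_exp_def)
  qed (use base \<rho> d_nonneg constants interval in auto)
  finally show ?thesis .
qed

text \<open>
  The maximum with \<open>1\<close> covers the empty word, about which the decay of \<open>\<mu>\<close> on cylinders says nothing.
\<close>

definition level_mass :: "nat \<Rightarrow> real" where "level_mass k = max C3 1 * b powr (- \<gamma> * real k)"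
definition "ratio1 = b powr (\<beta> - \<alpha> * d - \<gamma>)"
definition "ratio2 = b powr (\<beta> * interp_exp - \<gamma>)"
definition "level_const = max C3 1 * (1 / (1 - ratio1) + 1 / (1 - ratio2))"

text \<open>
  This is the place where the two conditions on \<open>d\<close> enter: each makes one of the two geometric
  series over the levels converge.
\<close>

lemma ratio_bounds: "0 < ratio1" "ratio1 < 1" "0 < ratio2" "ratio2 < 1"
proof -
  have "\<beta> - \<alpha> * d - \<gamma> < 0" using dimension(2) constants by (simp add: field_simps)
  moreover have "\<beta> * interp_exp - \<gamma> < 0"
    using dimension(1) constants by (auto simp: interp_exp_def max_def field_simps)
  ultimately show "0 < ratio1" "ratio1 < 1" "0 < ratio2" "ratio2 < 1"
    using base powr_less_mono[of _ 0 b] by (auto simp: ratio1_def ratio2_def)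
qed

lemma level_sum: "(\<Sum>k<n. level_mass k * level_energy k) \<le> level_const"
proof -
  have power: "b powr (- \<gamma> * real k) * b powr x = (b powr y) ^ k" if "x = real k * (y + \<gamma>)" for x y k
  proof -
    have "b powr (- \<gamma> * real k) * b powr x = b powr (y * real k)"
      unfolding powr_add[symmetric] that by (simp add: algebra_simps)
    also have "\<dots> = (b powr y) powr real k" by (simp add: powr_powr)
    also have "\<dots> = (b powr y) ^ k" using base by (simp add: powr_realpow)
    finally show ?thesis .
  qed
  have "level_mass k * level_energy k = max C3 1 * (ratio1 ^ k + ratio2 ^ k)" for k
    unfolding ratio1_def ratio2_def level_mass_def level_energy_def mult.assoc distrib_left
    by (subst (1 2) power[symmetric]) (auto simp: algebra_simps)
  then have "(\<Sum>k<n. level_mass k * level_energy k) = max C3 1 * ((\<Sum>k<n. ratio1 ^ k) + (\<Sum>k<n. ratio2 ^ k))"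
    by (simp add: sum_distrib_left sum.distrib distrib_left)
  also have "\<dots> \<le> level_const"
    unfolding level_const_def using ratio_bounds
    by (intro mult_left_mono add_mono sum_power_le_geometric) auto
  finally show ?thesis .
qed

lemma level_mass_nonneg: "0 \<le> level_mass k" by (simp add: level_mass_def)

lemma cylinder_mass: "measure \<mu> (cylinder A u) \<le> level_mass (length u)"
proof (cases "length u = 0")
  case True
  then show ?thesis using mu.prob_le_1 base by (simp add: level_mass_def le_max_iff_disj)
next
  case False
  then have "measure \<mu> (cylinder A u) \<le> C3 * b powr (- \<gamma> * real (length u))"
    by (intro mu_cylinder) (simp add: Suc_le_eq)
  also have "\<dots> \<le> level_mass (length u)" unfolding level_mass_def by (intro mult_right_mono) auto
  finally show ?thesis .
qed

lemma sum_cylinders_le: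
  assumes "finite U" and "\<And>u. u \<in> U \<Longrightarrow> length u = n" and "\<And>u. u \<in> U \<Longrightarrow> cylinder A u \<subseteq> B" and "B \<in> sets \<mu>"
  shows "(\<Sum>u\<in>U. measure \<mu> (cylinder A u)) \<le> measure \<mu> B"
proof -
  have "disjoint_family_on (cylinder A) U"
    unfolding disjoint_family_on_def
  proof safe
    fix u u' \<omega> assume u: "u \<in> U" "u' \<in> U" "u \<noteq> u'" "\<omega> \<in> cylinder A u" "\<omega> \<in> cylinder A u'"
    have "u = u'"
      using u(4,5) assms(2)[OF u(1)] assms(2)[OF u(2)] unfolding cylinder_iff
      by (intro nth_equalityI) auto
    then show "\<omega> \<in> {}" using u(3) by simp
  qed
  then have "(\<Sum>u\<in>U. measure \<mu> (cylinder A u)) = measure \<mu> (\<Union>u\<in>U. cylinder A u)"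
    using \<open>finite U\<close> by (intro mu.finite_measure_finite_Union[symmetric]) auto
  also have "\<dots> \<le> measure \<mu> B" using assms(3,4) by (intro mu.finite_measure_mono) auto
  finally show ?thesis .
qed

text \<open>
  The part of the convolution that comes from the sequences starting with \<open>w\<close>. If \<open>w\<close> has length
  \<open>k0\<close>, any two distinct such sequences obey the transversality condition.
\<close>

definition piece :: "'a list \<Rightarrow> real \<Rightarrow> real measure" where
  "piece w t = (\<eta> \<star> distr (density \<mu> (indicator (cylinder A w))) borel (P t))"

text \<open>
  The majorant \<open>T\<close> is a finite sum over pairs of cylinders. It is measurable in the parameter because
  each difference of two representatives is, and its integral is bounded level by level.
\<close>

lemma piece_energy:
  assumes w: "length w = k0" and \<rho>: "0 < \<rho>" "\<rho> \<le> 1"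
  shows "\<exists>T. T \<in> borel_measurable J \<and> (\<forall>t\<in>{l0..l1}. closeness (piece w t) 0 (\<rho> / 3) \<le> T t) \<and>
    (\<integral>\<^sup>+t. T t \<partial>J) \<le> ennreal ((max C3 1 * C4 * (l1 - l0) + pair_const * level_const) * \<rho>)"
proof -
  \<comment> \<open>The first inequality keeps the image of a cylinder of length \<open>n\<close> within \<open>\<rho> / 3\<close> of one of its points;
   the second one makes the pairs of equal cylinders contribute only \<open>O(\<rho>)\<close>.\<close>
  obtain n where n: "k0 \<le> n" "C1 * b powr (- \<alpha> * real n) \<le> \<rho> / 3" "b powr (- \<gamma> * real n) \<le> \<rho>"
  proof -
    have lim: "(\<lambda>n. b powr (- c * real n)) \<longlonglongrightarrow> 0" if "0 < c" for c
    proof -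
      have "(\<lambda>n. (b powr (- c)) ^ n) \<longlonglongrightarrow> 0"
        using base that powr_less_mono[of "- c" 0 b] by (intro LIMSEQ_realpow_zero) auto
      moreover have "(b powr (- c)) ^ n = b powr (- c * real n)" for n
        using base by (simp add: powr_powr flip: powr_realpow)
      ultimately show ?thesis by simp
    qed
    have "(\<lambda>n. C1 * b powr (- \<alpha> * real n)) \<longlonglongrightarrow> 0"
      using tendsto_mult_right_zero[OF lim[OF constants(5)]] by simp
    then have "\<forall>\<^sub>F n in sequentially. C1 * b powr (- \<alpha> * real n) < \<rho> / 3"
      using \<rho> by (intro order_tendstoD) auto
    moreover have "\<forall>\<^sub>F n in sequentially. b powr (- \<gamma> * real n) < \<rho>"
      using lim[OF constants(7)] \<rho>(1) by (rule order_tendstoD)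
    ultimately have "\<forall>\<^sub>F n in sequentially. k0 \<le> n \<and> C1 * b powr (- \<alpha> * real n) \<le> \<rho> / 3 \<and> b powr (- \<gamma> * real n) \<le> \<rho>"
      using eventually_ge_at_top[of k0] by eventually_elim auto
    then show thesis using that by (auto simp: eventually_sequentially)
  qed
  define U where "U = {u :: 'a list. length u = n \<and> take k0 u = w \<and> cylinder A u \<noteq> {}}"
  define p where "p u = (SOME \<omega>. \<omega> \<in> cylinder A u)" for u
  define m where "m u = measure \<mu> (cylinder A u)" for u
  define lev where "lev u u' = common_prefix_length (p u) (p u')" for u u'
  have finU: "finite U"
    by (rule finite_subset[OF _ finite_lists_length_eq[of "UNIV :: 'a set" n]]) (auto simp: U_def)
  have p: "p u \<in> cylinder A u" if "u \<in> U" for u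
    using that someI_ex[of "\<lambda>\<omega>. \<omega> \<in> cylinder A u"] unfolding p_def U_def by blast
  then have p_nth: "p u i = u ! i" if "u \<in> U" "i < n" for u i
    using that by (auto simp: U_def cylinder_iff)
  have p_chain: "p u \<in> markov_chain A" if "u \<in> U" for u using p[OF that] by (simp add: cylinder_iff)
  have prefix: "u ! i = w ! i" if "u \<in> U" "i < k0" for u i
    using that nth_take[of i k0 u] by (auto simp: U_def)
  have cover: "(\<Union>u\<in>U. cylinder A u) = cylinder A w"
  proof safe
    fix \<omega> u assume "u \<in> U" "\<omega> \<in> cylinder A u"
    then show "\<omega> \<in> cylinder A w"
      using n(1) w prefix[OF \<open>u \<in> U\<close>] unfolding cylinder_iff by (simp add: U_def)
  next
    fix \<omega> assume \<omega>: "\<omega> \<in> cylinder A w"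
    define u where "u = map \<omega> [0..<n]"
    have "\<omega> \<in> cylinder A u" using \<omega> by (auto simp: cylinder_iff u_def)
    moreover have "take k0 u = w"
      using \<omega> n(1) w unfolding u_def cylinder_iff by (intro nth_equalityI) auto
    ultimately have "u \<in> U" by (auto simp: U_def u_def)
    then show "\<omega> \<in> (\<Union>u\<in>U. cylinder A u)" using \<open>\<omega> \<in> cylinder A u\<close> by blast
  qed
  have sep: "p u \<noteq> p u'" "k0 \<le> lev u u'" "lev u u' < n" if u: "u \<in> U" "u' \<in> U" "u \<noteq> u'" for u u'
  proof -
    obtain i where i: "i < n" "u ! i \<noteq> u' ! i" using u nth_equalityI[of u u'] by (auto simp: U_def)
    then have ne: "p u i \<noteq> p u' i" using p_nth u by simp
    then show "p u \<noteq> p u'" by auto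
    then show "lev u u' < n"
      unfolding lev_def using common_prefix_length_le ne i(1) by (meson le_less_trans)
    have "p u i = p u' i" if "i < k0" for i
      using prefix[OF u(1) that] prefix[OF u(2) that] p_nth u n(1) that by simp
    then show "k0 \<le> lev u u'" unfolding lev_def using \<open>p u \<noteq> p u'\<close> by (intro common_prefix_length_ge)
  qed
  define T where "T t = (\<Sum>u\<in>U. \<Sum>u'\<in>U. emeasure \<mu> (cylinder A u) * emeasure \<mu> (cylinder A u')
    * closeness \<eta> (phi P (p u) (p u') t) \<rho>)" for t
  have phi_m[measurable]: "(\<lambda>t. phi P (p u) (p u') t) \<in> borel_measurable J" if "u \<in> U" "u' \<in> U" for u u'
  proof (cases "u = u'")
    case False
    then show ?thesis using phi_measurable[OF p_chain p_chain] sep that by (simp add: lev_def)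
  qed (simp add: phi_def)
  note [measurable_cong] = eta(2)
  have close_m: "(\<lambda>v. closeness \<eta> v \<rho>) \<in> borel_measurable borel"
    unfolding closeness_def by measurable
  have T_term: "(\<lambda>t. closeness \<eta> (phi P (p u) (p u') t) \<rho>) \<in> borel_measurable J" if "u \<in> U" "u' \<in> U" for u u'
    by (rule measurable_compose[OF phi_m[OF that] close_m])
  have "T \<in> borel_measurable J"
    unfolding T_def using T_term by (intro borel_measurable_sum borel_measurable_times) auto
  moreover have "closeness (piece w t) 0 (\<rho> / 3) \<le> T t" if t: "t \<in> {l0..l1}" for t
  proof -
    have near: "\<bar>P t \<omega> - P t (p u)\<bar> \<le> \<rho> / 3" if u: "u \<in> U" "\<omega> \<in> cylinder A u" for u \<omega>
    proof (cases "\<omega> = p u")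
      case False
      have \<omega>: "\<omega> \<in> markov_chain A" and "\<And>i. i < n \<Longrightarrow> \<omega> i = p u i"
        using u p_nth by (auto simp: cylinder_iff U_def)
      then have "n \<le> common_prefix_length \<omega> (p u)" using False by (intro common_prefix_length_ge)
      then have "b powr (- \<alpha> * real (common_prefix_length \<omega> (p u))) \<le> b powr (- \<alpha> * real n)"
        using base constants by (intro powr_mono) auto
      then have "C1 * b powr (- \<alpha> * real (common_prefix_length \<omega> (p u))) \<le> C1 * b powr (- \<alpha> * real n)"
        using constants by (intro mult_left_mono) auto
      then show ?thesis
        using phi_bound[OF \<omega> p_chain[OF u(1)] False t] n(2) by (simp add: phi_def)
    qed (use \<rho> in simp)
    show ?thesis
      using closeness_convolution_le_sum[where B="cylinder A" and p="\<lambda>u. P t (p u)",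
          OF eta.finite_measure_axioms eta(2) mu.finite_measure_axioms P_measurable[OF t] finU
             cylinder_measurable near]
      by (simp add: cover piece_def T_def phi_def)
  qed
  moreover have "(\<integral>\<^sup>+t. T t \<partial>J) \<le> ennreal ((max C3 1 * C4 * (l1 - l0) + pair_const * level_const) * \<rho>)"
  proof -
    define D where "D = C4 * (l1 - l0)"
    have D: "0 \<le> D" using constants interval by (simp add: D_def)
    have pair: "(\<integral>\<^sup>+t. closeness \<eta> (phi P (p u) (p u') t) \<rho> \<partial>J)
        \<le> ennreal (if u = u' then D else pair_const * \<rho> * level_energy (lev u u'))" if u: "u \<in> U" "u' \<in> U" for u u'
    proof (cases "u = u'")
      case True
      have "(\<integral>\<^sup>+t. closeness \<eta> (phi P (p u) (p u') t) \<rho> \<partial>J) \<le> (\<integral>\<^sup>+t. ennreal C4 \<partial>J)"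
      proof (intro nn_integral_mono)
        fix t
        have "closeness \<eta> (phi P (p u) (p u') t) \<rho> \<le> ennreal (C4 * \<rho> powr d)"
          by (rule closeness_le_frostman[OF eta eta_frostman \<rho>(1)])
        also have "\<dots> \<le> ennreal (C4 * 1)"
          using \<rho> d_nonneg constants by (intro ennreal_leI mult_left_mono powr_le1) auto
        finally show "closeness \<eta> (phi P (p u) (p u') t) \<rho> \<le> ennreal C4" by simp
      qed
      also have "\<dots> = ennreal D"
        unfolding nn_integral_const emeasure_J D_def using constants interval by (simp add: ennreal_mult)
      finally show ?thesis using True by simp
    next
      case False
      then show ?thesis
        using pair_energy[OF p_chain p_chain _ _ \<rho>] sep[OF u False] u by (simp add: lev_def)
    qed
    have "(\<integral>\<^sup>+t. T t \<partial>J) = (\<Sum>u\<in>U. \<Sum>u'\<in>U. ennreal (m u * m u')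
        * (\<integral>\<^sup>+t. closeness \<eta> (phi P (p u) (p u') t) \<rho> \<partial>J))"
      unfolding T_def using T_term
      by (simp add: nn_integral_sum nn_integral_cmult mu.emeasure_eq_measure m_def ennreal_mult)
    also have "\<dots> \<le> (\<Sum>u\<in>U. \<Sum>u'\<in>U. ennreal (m u * m u')
        * ennreal (if u = u' then D else pair_const * \<rho> * level_energy (lev u u')))"
      by (intro sum_mono mult_left_mono pair) auto
    also have "\<dots> = ennreal (\<Sum>u\<in>U. \<Sum>u'\<in>U. m u * m u' * (if u = u' then D else pair_const * \<rho> * level_energy (lev u u')))"
    proof -
      have "0 \<le> m u" for u by (simp add: m_def)
      moreover have "0 \<le> (if u = u' then D else pair_const * \<rho> * level_energy (lev u u'))" for u u'
        using D pair_const_nonneg \<rho> level_energy_nonneg by simp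
      ultimately show ?thesis
        by (simp add: sum_nonneg mult_nonneg_nonneg flip: ennreal_mult)
    qed
    also have "\<dots> \<le> ennreal ((max C3 1 * \<rho>) * D + (\<Sum>k<n. level_mass k * (pair_const * \<rho> * level_energy k)))"
    proof (intro ennreal_leI sum_pairs_by_level finU)
      show "m u \<le> max C3 1 * \<rho>" if "u \<in> U" for u
      proof -
        have "m u \<le> max C3 1 * b powr (- \<gamma> * real n)"
          using cylinder_mass[of u] that by (simp add: m_def level_mass_def U_def)
        also have "\<dots> \<le> max C3 1 * \<rho>" using n(3) by (intro mult_left_mono) auto
        finally show ?thesis .
      qed
      have "sum m U \<le> measure \<mu> (space \<mu>)"
        unfolding m_def
        by (intro sum_cylinders_le[where n=n] finU) (use sets.top[of \<mu>] in \<open>auto simp: U_def cylinder_iff space_mu\<close>)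
      then show "sum m U \<le> 1" by (simp add: mu.prob_space)
      show "sum m {u' \<in> U. u' \<noteq> u \<and> lev u u' = k} \<le> level_mass k" if u: "u \<in> U" and k: "k < n" for u k
      proof -
        have "sum m {u' \<in> U. u' \<noteq> u \<and> lev u u' = k} \<le> measure \<mu> (cylinder A (take k u))"
          unfolding m_def
        proof (intro sum_cylinders_le[where n=n])
          fix u' assume u': "u' \<in> {u' \<in> U. u' \<noteq> u \<and> lev u u' = k}"
          then have "p u \<noteq> p u'" using sep[OF u] by auto
          then have "p u i = p u' i" if "i < k" for i
            using agree_below_common_prefix[of "p u" "p u'"] that u' by (simp add: lev_def)
          then have "u ! i = u' ! i" if "i < k" for i
            using that k p_nth u u' by simp
          then show "cylinder A u' \<subseteq> cylinder A (take k u)"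
            using k u u' by (auto simp: cylinder_iff U_def)
        next
          show "finite {u' \<in> U. u' \<noteq> u \<and> lev u u' = k}" using finU by simp
        qed (auto simp: U_def)
        also have "\<dots> \<le> level_mass k" using cylinder_mass[of "take k u"] u k by (simp add: U_def)
        finally show ?thesis .
      qed
    qed (use sep D pair_const_nonneg level_energy_nonneg level_mass_nonneg \<rho> in \<open>auto simp: m_def\<close>)
    also have "\<dots> \<le> ennreal ((max C3 1 * C4 * (l1 - l0) + pair_const * level_const) * \<rho>)"
    proof (rule ennreal_leI)
      have "(\<Sum>k<n. level_mass k * (pair_const * \<rho> * level_energy k)) = pair_const * \<rho> * (\<Sum>k<n. level_mass k * level_energy k)"
        by (simp add: sum_distrib_left mult_ac)
      also have "\<dots> \<le> pair_const * \<rho> * level_const" using level_sum pair_const_nonneg \<rho> by (intro mult_left_mono) auto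
      finally show "(max C3 1 * \<rho>) * D + (\<Sum>k<n. level_mass k * (pair_const * \<rho> * level_energy k))
          \<le> (max C3 1 * C4 * (l1 - l0) + pair_const * level_const) * \<rho>"
        by (simp add: D_def algebra_simps)
    qed
    finally show ?thesis .
  qed
  ultimately show ?thesis by blast
qed

lemma piece_props:
  assumes "t \<in> {l0..l1}"
  shows finite_piece: "finite_measure (piece w t)" and sets_piece: "sets (piece w t) = sets borel"
    and nn_integral_piece: "g \<in> borel_measurable borel \<Longrightarrow>
      (\<integral>\<^sup>+z. g z \<partial>piece w t) = (\<integral>\<^sup>+x. \<integral>\<^sup>+\<omega>. indicator (cylinder A w) \<omega> * g (x + P t \<omega>) \<partial>\<mu> \<partial>\<eta>)"
proof -
  have m: "P t \<in> borel_measurable \<mu>" by (rule P_measurable[OF assms])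
  have "finite_measure (density \<mu> (indicator (cylinder A w)))"
    by (rule finite_measure_density_indicator[OF mu.finite_measure_axioms cylinder_measurable])
  then have "finite_measure (distr (density \<mu> (indicator (cylinder A w))) borel (P t))"
    by (rule finite_measure.finite_measure_distr) (simp add: m)
  then show "finite_measure (piece w t)"
    unfolding piece_def by (intro convolution_finite eta.finite_measure_axioms) (auto simp: eta(2))
  show "sets (piece w t) = sets borel" by (simp add: piece_def)
  show "(\<integral>\<^sup>+z. g z \<partial>piece w t) = (\<integral>\<^sup>+x. \<integral>\<^sup>+\<omega>. indicator (cylinder A w) \<omega> * g (x + P t \<omega>) \<partial>\<mu> \<partial>\<eta>)"
    if "g \<in> borel_measurable borel"
    unfolding piece_def
    by (rule nn_integral_convolution_piece[OF eta.finite_measure_axioms eta(2)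
          mu.finite_measure_axioms cylinder_measurable m that])
qed

text \<open>
  Rescaled by \<open>1 / \<rho>\<close>, the majorants of the energy at the scales \<open>\<rho> = 1 / (m + 1)\<close> have bounded
  integrals. By Fatou's lemma their lower limit is finite for almost every parameter, which gives a
  sequence of scales, depending on the parameter, for the density criterion.
\<close>

lemma piece_L2_bound:
  assumes w: "length w = k0"
  shows "AE t in J. \<exists>K\<ge>0. \<forall>g\<in>borel_measurable borel.
    (\<integral>\<^sup>+x. g x \<partial>piece w t)\<^sup>2 \<le> ennreal K * (\<integral>\<^sup>+x. (g x)\<^sup>2 \<partial>lborel)"
proof -
  define \<rho> :: "nat \<Rightarrow> real" where "\<rho> m = 1 / (real m + 1)" for m
  have \<rho>: "0 < \<rho> m" "\<rho> m \<le> 1" for m by (auto simp: \<rho>_def)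
  define K where "K = max C3 1 * C4 * (l1 - l0) + pair_const * level_const"
  obtain T where T: "\<And>m. T m \<in> borel_measurable J"
    "\<And>m t. t \<in> {l0..l1} \<Longrightarrow> closeness (piece w t) 0 (\<rho> m / 3) \<le> T m t"
    "\<And>m. (\<integral>\<^sup>+t. T m t \<partial>J) \<le> ennreal (K * \<rho> m)"
    using piece_energy[OF w \<rho>] unfolding K_def by metis
  define X where "X m t = ennreal (real m + 1) * T m t" for m t
  have [measurable]: "X m \<in> borel_measurable J" for m
    unfolding X_def using T(1)[of m] by measurable
  have X_int: "(\<integral>\<^sup>+t. X m t \<partial>J) \<le> ennreal K" for m
  proof -
    have "(\<integral>\<^sup>+t. X m t \<partial>J) = ennreal (real m + 1) * (\<integral>\<^sup>+t. T m t \<partial>J)"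
      unfolding X_def by (rule nn_integral_cmult[OF T(1)])
    also have "\<dots> \<le> ennreal (real m + 1) * ennreal (K * \<rho> m)" by (intro mult_left_mono T(3)) simp
    also have "\<dots> = ennreal ((real m + 1) * (K * \<rho> m))" by (subst ennreal_mult') auto
    also have "(real m + 1) * (K * \<rho> m) = K" by (simp add: \<rho>_def)
    finally show ?thesis .
  qed
  have "(\<integral>\<^sup>+t. liminf (\<lambda>m. X m t) \<partial>J) \<le> liminf (\<lambda>m. \<integral>\<^sup>+t. X m t \<partial>J)"
    by (rule nn_integral_liminf) measurable
  also have "\<dots> \<le> ennreal K" by (intro Liminf_le always_eventually allI X_int) simp
  finally have "(\<integral>\<^sup>+t. liminf (\<lambda>m. X m t) \<partial>J) \<noteq> \<infinity>"
    by (metis ennreal_less_top infinity_ennreal_def not_le)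
  then have "AE t in J. liminf (\<lambda>m. X m t) \<noteq> \<infinity>"
    by (intro nn_integral_PInf_AE) measurable
  then show ?thesis
    using AE_space
  proof eventually_elim
    case (elim t)
    then have t: "t \<in> {l0..l1}" by simp
    obtain c :: real where c: "0 \<le> c" "liminf (\<lambda>m. X m t) = ennreal c"
      using elim(1) by (cases "liminf (\<lambda>m. X m t)") auto
    have "\<exists>m\<ge>j. X m t \<le> ennreal (c + 1)" for j
    proof (rule ccontr)
      assume "\<not> ?thesis"
      then have "\<forall>\<^sub>F m in sequentially. ennreal (c + 1) \<le> X m t"
        by (intro eventually_sequentiallyI[of j]) (meson linear)
      then have "ennreal (c + 1) \<le> ennreal c" unfolding c(2)[symmetric] by (rule Liminf_bounded)
      then show False using c(1) by simp
    qed
    then obtain \<sigma> where \<sigma>: "\<And>j. j \<le> \<sigma> j" "\<And>j. X (\<sigma> j) t \<le> ennreal (c + 1)" by metis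
    \<comment> \<open>The density criterion needs energy at scale \<open>2 r\<close>, and the majorant controls it at \<open>\<rho> / 3\<close>.\<close>
    define r where "r j = \<rho> (\<sigma> j) / 6" for j
    have r0: "0 < r j" for j using \<rho> by (simp add: r_def)
    have "r \<longlonglongrightarrow> 0"
    proof (rule tendsto_sandwich[of "\<lambda>_. 0" _ _ "\<lambda>j. 1 / (real j + 1)"])
      have "r j \<le> 1 / (real j + 1)" for j
      proof -
        have "r j \<le> \<rho> (\<sigma> j)" using \<rho>(1)[of "\<sigma> j"] by (simp add: r_def)
        also have "\<dots> \<le> 1 / (real j + 1)"
          unfolding \<rho>_def using \<sigma>(1)[of j] by (intro divide_left_mono) auto
        finally show ?thesis .
      qed
      then show "\<forall>\<^sub>F j in sequentially. r j \<le> 1 / (real j + 1)" by simp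
      show "(\<lambda>j. 1 / (real j + 1)) \<longlonglongrightarrow> 0"
        using LIMSEQ_inverse_real_of_nat by (simp add: inverse_eq_divide add.commute)
      show "\<forall>\<^sub>F j in sequentially. 0 \<le> r j"
        using r0 by (intro always_eventually allI less_imp_le)
    qed simp
    have energy: "closeness (piece w t) 0 (2 * r j) \<le> ennreal (3 * (c + 1) * (2 * r j))" for j
    proof -
      have one: "ennreal (\<rho> (\<sigma> j)) * ennreal (real (\<sigma> j) + 1) = 1"
        by (subst ennreal_mult'[symmetric]) (auto simp: \<rho>_def)
      have "closeness (piece w t) 0 (2 * r j) \<le> T (\<sigma> j) t"
        using T(2)[OF t, of "\<sigma> j"] by (simp add: r_def)
      also have "\<dots> = ennreal (\<rho> (\<sigma> j)) * X (\<sigma> j) t"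
        unfolding X_def mult.assoc[symmetric] one by simp
      also have "\<dots> \<le> ennreal (\<rho> (\<sigma> j)) * ennreal (c + 1)" by (intro mult_left_mono \<sigma>(2)) simp
      also have "\<dots> = ennreal (\<rho> (\<sigma> j) * (c + 1))"
        using \<rho>(1)[of "\<sigma> j"] by (subst ennreal_mult') auto
      also have "\<rho> (\<sigma> j) * (c + 1) = 3 * (c + 1) * (2 * r j)" by (simp add: r_def)
      finally show ?thesis .
    qed
    show ?case
    proof (intro exI[of _ "3 * (c + 1)"] conjI ballI)
      show "(\<integral>\<^sup>+x. g x \<partial>piece w t)\<^sup>2 \<le> ennreal (3 * (c + 1)) * (\<integral>\<^sup>+x. (g x)\<^sup>2 \<partial>lborel)"
        if "g \<in> borel_measurable borel" for g
        using c(1) by (intro L2_bound_of_energy[OF finite_piece[OF t] sets_piece[OF t] r0 \<open>r \<longlonglongrightarrow> 0\<close> energy _ that]) simp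
    qed (use c(1) in simp)
  qed
qed

text \<open>
  A bound \<open>\<integral>g \<partial>\<theta> \<le> B\<close>, with \<open>B\<^sup>2 = K \<integral>g\<^sup>2\<close>, for each piece gives the bound \<open>card W * B\<close> for the whole
  convolution.
\<close>

theorem convolution_L2_density:
  "AE t in J. absolutely_continuous lborel (\<eta> \<star> distr \<mu> borel (P t)) \<and>
     (\<exists>f :: real \<Rightarrow> real. f \<in> borel_measurable borel \<and> (\<forall>x. f x \<ge> 0) \<and>
        (\<eta> \<star> distr \<mu> borel (P t)) = density lborel (\<lambda>x. ennreal (f x)) \<and>
        integrable lborel (\<lambda>x. (f x)\<^sup>2))"
proof -
  define W where "W = {w :: 'a list. length w = k0}"
  have finW: "finite W" using finite_lists_length_eq[of "UNIV :: 'a set" k0] by (simp add: W_def)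
  have "AE t in J. \<forall>w\<in>W. \<exists>K\<ge>0. \<forall>g\<in>borel_measurable borel.
      (\<integral>\<^sup>+x. g x \<partial>piece w t)\<^sup>2 \<le> ennreal K * (\<integral>\<^sup>+x. (g x)\<^sup>2 \<partial>lborel)"
    using piece_L2_bound by (intro eventually_ball_finite finW) (auto simp: W_def)
  then show ?thesis
    using AE_space
  proof eventually_elim
    case (elim t)
    then have t: "t \<in> {l0..l1}" by simp
    have Pm[measurable]: "P t \<in> borel_measurable \<mu>" by (rule P_measurable[OF t])
    obtain k where k: "\<And>w. w \<in> W \<Longrightarrow> 0 \<le> k w"
      "\<And>w g. w \<in> W \<Longrightarrow> g \<in> borel_measurable borel \<Longrightarrow>
        (\<integral>\<^sup>+x. g x \<partial>piece w t)\<^sup>2 \<le> ennreal (k w) * (\<integral>\<^sup>+x. (g x)\<^sup>2 \<partial>lborel)"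
      using elim(1) by metis
    define K where "K = sum k W"
    have K: "0 \<le> K" "\<And>w. w \<in> W \<Longrightarrow> k w \<le> K"
      unfolding K_def using k(1) finW by (auto intro: sum_nonneg member_le_sum)
    let ?\<theta> = "\<eta> \<star> distr \<mu> borel (P t)"
    have fin_distr: "finite_measure (distr \<mu> borel (P t))"
      by (rule mu.finite_measure_distr) measurable
    have fin: "finite_measure ?\<theta>"
      by (intro convolution_finite eta.finite_measure_axioms fin_distr) (auto simp: eta(2))
    have "(\<integral>\<^sup>+z. g z \<partial>?\<theta>)\<^sup>2 \<le> ennreal ((real (card W))\<^sup>2 * K) * (\<integral>\<^sup>+x. (g x)\<^sup>2 \<partial>lborel)"
      if g[measurable]: "g \<in> borel_measurable borel" for g
    proof -
      obtain B :: ennreal where B: "B\<^sup>2 = ennreal K * (\<integral>\<^sup>+x. (g x)\<^sup>2 \<partial>lborel)"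
        "\<And>x. x\<^sup>2 \<le> ennreal K * (\<integral>\<^sup>+x. (g x)\<^sup>2 \<partial>lborel) \<longleftrightarrow> x \<le> B"
        using ennreal_ex_sqrt by metis
      have piece_le: "(\<integral>\<^sup>+z. g z \<partial>piece w t) \<le> B" if "w \<in> W" for w
      proof -
        have "(\<integral>\<^sup>+z. g z \<partial>piece w t)\<^sup>2 \<le> ennreal (k w) * (\<integral>\<^sup>+x. (g x)\<^sup>2 \<partial>lborel)"
          by (rule k(2)[OF that g])
        also have "\<dots> \<le> ennreal K * (\<integral>\<^sup>+x. (g x)\<^sup>2 \<partial>lborel)"
          using K(2)[OF that] by (intro mult_right_mono ennreal_leI) auto
        finally show ?thesis by (simp only: B(2))
      qed
      note [measurable_cong] = eta(2)
      have "(\<integral>\<^sup>+z. g z \<partial>?\<theta>) = (\<integral>\<^sup>+x. \<integral>\<^sup>+y. g (x + y) \<partial>distr \<mu> borel (P t) \<partial>\<eta>)"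
        by (intro nn_integral_convolution eta.finite_measure_axioms fin_distr g) (auto simp: eta(2))
      also have "\<dots> = (\<integral>\<^sup>+x. \<integral>\<^sup>+\<omega>. g (x + P t \<omega>) \<partial>\<mu> \<partial>\<eta>)"
        by (intro nn_integral_cong nn_integral_distr) measurable
      also have "\<dots> \<le> (\<integral>\<^sup>+x. \<integral>\<^sup>+\<omega>. (\<Sum>w\<in>W. indicator (cylinder A w) \<omega> * g (x + P t \<omega>)) \<partial>\<mu> \<partial>\<eta>)"
      proof (intro nn_integral_mono)
        fix x \<omega> assume "\<omega> \<in> space \<mu>"
        then have "\<omega> \<in> cylinder A (map \<omega> [0..<k0])" by (simp add: cylinder_iff space_mu)
        moreover have "map \<omega> [0..<k0] \<in> W" by (simp add: W_def)
        ultimately show "g (x + P t \<omega>) \<le> (\<Sum>w\<in>W. indicator (cylinder A w) \<omega> * g (x + P t \<omega>))"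
          using member_le_sum[of "map \<omega> [0..<k0]" W "\<lambda>w. indicator (cylinder A w) \<omega> * g (x + P t \<omega>)"] finW
          by simp
      qed
      also have "\<dots> = (\<integral>\<^sup>+x. (\<Sum>w\<in>W. \<integral>\<^sup>+\<omega>. indicator (cylinder A w) \<omega> * g (x + P t \<omega>) \<partial>\<mu>) \<partial>\<eta>)"
        by (intro nn_integral_cong nn_integral_sum) measurable
      also have "\<dots> = (\<Sum>w\<in>W. \<integral>\<^sup>+x. \<integral>\<^sup>+\<omega>. indicator (cylinder A w) \<omega> * g (x + P t \<omega>) \<partial>\<mu> \<partial>\<eta>)"
        by (intro nn_integral_sum) measurable
      also have "\<dots> = (\<Sum>w\<in>W. \<integral>\<^sup>+z. g z \<partial>piece w t)"
        by (simp only: nn_integral_piece[OF t g])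
      also have "\<dots> \<le> (\<Sum>w\<in>W. B)" by (intro sum_mono piece_le)
      also have "\<dots> = ennreal (real (card W)) * B" by (simp add: ennreal_of_nat_eq_real_of_nat)
      finally have "(\<integral>\<^sup>+z. g z \<partial>?\<theta>)\<^sup>2 \<le> (ennreal (real (card W)) * B)\<^sup>2" by (rule power_mono) simp
      also have "\<dots> = ennreal ((real (card W))\<^sup>2 * K) * (\<integral>\<^sup>+x. (g x)\<^sup>2 \<partial>lborel)"
        using K(1) by (simp only: power_mult_distrib B(1) ennreal_mult' ennreal_power of_nat_0_le_iff mult.assoc zero_le_power2)
      finally show ?thesis .
    qed
    then show ?case by (intro L2_density_of_bound[OF fin]) auto
  qed
qed

end

theorem proposition2p1:
  fixes A :: "real^('a::{finite, discrete_topology})^('a::{finite, discrete_topology})"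
    and \<mu> :: "(nat \<Rightarrow> 'a) measure"
    and P :: "real \<Rightarrow> (nat \<Rightarrow> 'a) \<Rightarrow> real"
    and \<eta> :: "real measure"
    and l0 l1 C1 C2 C3 C4 \<alpha> \<beta> \<gamma> d :: real
    and k0 :: nat
  assumes alphabet: "CARD('a) \<ge> 2"
    and matrix: "zero_one_matrix A" "primitive_matrix A"
    and mu: "prob_space \<mu>" "sets \<mu> = sets (restrict_space borel (markov_chain A))"
    and interval: "l0 \<le> l1"
    and P_cont: "\<And>t. t \<in> {l0..l1} \<Longrightarrow> continuous_on (markov_chain A) (P t)"
    and P_cantor: "\<And>t. t \<in> {l0..l1} \<Longrightarrow> cantor_set (P t ` markov_chain A)"
    and constants: "C1 > 0" "C2 > 0" "C3 > 0" "C4 > 0" "\<alpha> > 0" "\<beta> > 0" "\<gamma> > 0"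
    and phi_bound:
      "\<And>\<omega> \<tau> t. \<omega> \<in> markov_chain A \<Longrightarrow> \<tau> \<in> markov_chain A \<Longrightarrow> \<omega> \<noteq> \<tau> \<Longrightarrow> t \<in> {l0..l1} \<Longrightarrow>
         \<bar>phi P \<omega> \<tau> t\<bar> \<le> C1 * real CARD('a) powr (- \<alpha> * real (common_prefix_length \<omega> \<tau>))"
    and level_sets_measurable:
      "\<And>\<omega> \<tau> v r. \<omega> \<in> markov_chain A \<Longrightarrow> \<tau> \<in> markov_chain A \<Longrightarrow> \<omega> \<noteq> \<tau> \<Longrightarrow>
         common_prefix_length \<omega> \<tau> \<ge> k0 \<Longrightarrow> r > 0 \<Longrightarrow>
         {t \<in> {l0..l1}. \<bar>v + phi P \<omega> \<tau> t\<bar> \<le> r} \<in> sets lebesgue"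
    and transversality:
      "\<And>\<omega> \<tau> r. \<omega> \<in> markov_chain A \<Longrightarrow> \<tau> \<in> markov_chain A \<Longrightarrow> \<omega> \<noteq> \<tau> \<Longrightarrow>
         common_prefix_length \<omega> \<tau> \<ge> k0 \<Longrightarrow> r > 0 \<Longrightarrow>
         (SUP v. emeasure lebesgue {t \<in> {l0..l1}. \<bar>v + phi P \<omega> \<tau> t\<bar> \<le> r})
           \<le> ennreal (C2 * real CARD('a) powr (real (common_prefix_length \<omega> \<tau>) * \<beta>) * r)"
    and mu_cylinder:
      "\<And>n u. n \<ge> 1 \<Longrightarrow> length u = n \<Longrightarrow>
         measure \<mu> (cylinder A u) \<le> C3 * real CARD('a) powr (- \<gamma> * real n)"
    and eta: "prob_space \<eta>" "sets \<eta> = sets borel" "compact (measure_support \<eta>)"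
    and d_nonneg: "d \<ge> 0"
    and eta_frostman: "\<And>x r. r > 0 \<Longrightarrow> measure \<eta> {x - r..x + r} \<le> C4 * r powr d"
    and dimension: "d + \<gamma> / \<beta> > 1" "d > (\<beta> - \<gamma>) / \<alpha>"
  shows "AE t in lebesgue. t \<in> {l0..l1} \<longrightarrow>
           absolutely_continuous lborel (\<eta> \<star> distr \<mu> borel (P t)) \<and>
           (\<exists>f :: real \<Rightarrow> real. f \<in> borel_measurable borel \<and> (\<forall>x. f x \<ge> 0) \<and>
              (\<eta> \<star> distr \<mu> borel (P t)) = density lborel (\<lambda>x. ennreal (f x)) \<and>
              integrable lborel (\<lambda>x. (f x)\<^sup>2))"
proof -
  interpret transversal_projections A \<mu> P \<eta> l0 l1 C1 C2 C3 C4 \<alpha> \<beta> \<gamma> d "real CARD('a)" k0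
  proof (rule transversal_projections.intro)
    show "1 < real CARD('a)" using alphabet by simp
    show "emeasure lebesgue {t \<in> {l0..l1}. \<bar>v + phi P \<omega> \<tau> t\<bar> \<le> r}
        \<le> ennreal (C2 * real CARD('a) powr (real (common_prefix_length \<omega> \<tau>) * \<beta>) * r)"
      if "\<omega> \<in> markov_chain A" "\<tau> \<in> markov_chain A" "\<omega> \<noteq> \<tau>"
        "k0 \<le> common_prefix_length \<omega> \<tau>" "0 < r" for \<omega> \<tau> v r
      using transversality[OF that] by (rule order_trans[OF SUP_upper[OF UNIV_I]])
    show "measure \<mu> (cylinder A u) \<le> C3 * real CARD('a) powr (- \<gamma> * real (length u))"
      if "1 \<le> length u" for u
      by (rule mu_cylinder[OF that refl])
  qed (rule mu interval P_cont constants phi_bound level_sets_measurable eta(1,2) d_nonneg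
      eta_frostman dimension | assumption)+
  have "{l0..l1} \<inter> space lebesgue \<in> sets lebesgue" by simp
  then show ?thesis
    using convolution_L2_density by (simp only: AE_restrict_space_iff)
qed

end
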